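(* Let $G$ be a diffeological group, and let $\Phi\colon G\times[0,1]\to G$ be a smooth strong deformation retraction of $G$ onto a subgroup $H$ such that for each $\tau\in[0,1]$ the map $\Phi(\cdot,\tau)\colon G\to G$ is a group homomorphism. Then, up to isomorphism, there is a smooth strong deformation retract of any weakly D-numerable principal $G$-bundle over a Hausdorff smoothly paracompact base to a principal $H$-bundle over the same base. That is: for any Hausdorff smoothly paracompact diffeological space $X$ and any weakly D-numerable principal $G$-bundle $E\to X$, there are a principal $G$-bundle $E'\to X$ isomorphic to $E$ and a subspace $P\subseteq E'$ that is a principal $H$-bundle over $X$, together with a smooth strong deformation retraction of $E'$ onto $P$.
   Context: Diffeology. A diffeology on a set $X$ is a collection of maps $p\colon U\to X$ ("plots"), $U$ open in some $\mathbb{R}^n$, $n\ge 0$, that contains constant maps, is closed under precomposition with smooth maps between open subsets of Euclidean spaces, and contains every map that is locally a plot. A map is smooth if its composition with every plot is a plot. The D-topology is the finest topology making all plots continuous; topological terms refer to it. Subsets (in particular subgroups) carry the subset diffeology, products the product diffeology, quotients the quotient diffeology; $[0,1]\subseteq\mathbb{R}$ has the subset diffeology. A diffeological group is a group with a diffeology for which multiplication and inversion are smooth. $X$ is smoothly paracompact if its D-topology is paracompact and every open cover admits a subordinate smooth partition of unity. A smooth strong deformation retraction of a diffeological space $Y$ onto a subspace $A$ is a smooth map $\Phi\colon Y\times[0,1]\to Y$ with $\Phi(\cdot,1)=\mathrm{id}_Y$, $\Phi(Y\times\{0\})\subseteq A$, and $\Phi(a,\tau)=a$ for all $a\in A$,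 $\tau\in[0,1]$. Bundles. For a smooth surjection $\pi\colon E\to X$ and smooth $f\colon Y\to X$, $f^*E=\{(y,e)\in Y\times E\mid f(y)=\pi(e)\}$. $\pi$ is trivial with fibre $F$ if there is a diffeomorphism $E\to X\times F$ over $X$; a local trivialisation is a D-open cover $\{U_\alpha\}$ with trivialisations of $E|_{U_\alpha}$; $\pi$ is a diffeological fibre bundle if $p^*E\to U$ is locally trivial for every plot $p\colon U\to X$. It is a principal $G$-bundle if moreover $G$ acts smoothly on $E$ and for every plot $p\colon U\to X$ and $u\in U$ there are an open neighbourhood $V$ of $u$ and a plot $q\colon V\to E$ with $\pi\circ q=p|_V$ such that $V\times G\to(p|_V)^*E$, $(v,g)\mapsto(v,g\cdot q(v))$ is an equivariant diffeomorphism. It is weakly D-numerable if there are a local trivialisation over a cover $\{U_i\}_{i\in\mathbb{N}}$ of $X$ and a pointwise-finite smooth partition of unity $\{\zeta_i\}_{i\in\mathbb{N}}$ with $\zeta_i^{-1}((0,1])\subseteq U_i$. Isomorphisms of principal $G$-bundles over $X$ are $G$-equivariant diffeomorphisms over $X$. *)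

theory Defs
  imports "HOL-Analysis.Analysis" "HOL-Algebra.Group_Action"
begin

section \<open>Smooth maps between open subsets of Euclidean spaces\<close>

text \<open>
  Plots have domains of arbitrary dimension, so the n-dimensional Euclidean space is rendered by the
  library's \<^term>\<open>Euclidean_space n\<close>: the sequences of reals vanishing from index n on.
  A real function is of class k+1 iff all its partial derivatives exist and are of class k.
  In the recursion \<open>D i\<close> is the partial derivative with respect to the i-th coordinate; the curve
  \<open>x(i := t)\<close> stays in the open set U for t near \<open>x i\<close>, so values of f outside U are
  irrelevant.
\<close>

primrec C_class :: "nat \<Rightarrow> nat \<Rightarrow> (nat \<Rightarrow> real) set \<Rightarrow> ((nat \<Rightarrow> real) \<Rightarrow> real) \<Rightarrow> bool" where
  "C_class 0 n U f \<longleftrightarrow> continuous_map (subtopology (Euclidean_space n) U) euclideanreal f"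
| "C_class (Suc k) n U f \<longleftrightarrow>
     (\<exists>D. \<forall>i<n. (\<forall>x\<in>U. ((\<lambda>t. f (x(i := t))) has_real_derivative D i x) (at (x i)))
               \<and> C_class k n U (D i))"

definition smooth_function :: "nat \<Rightarrow> (nat \<Rightarrow> real) set \<Rightarrow> ((nat \<Rightarrow> real) \<Rightarrow> real) \<Rightarrow> bool" where
  "smooth_function n U f \<longleftrightarrow> openin (Euclidean_space n) U \<and> (\<forall>k. C_class k n U f)"

definition smooth_euclidean ::
  "nat \<Rightarrow> (nat \<Rightarrow> real) set \<Rightarrow> nat \<Rightarrow> (nat \<Rightarrow> real) set \<Rightarrow> ((nat \<Rightarrow> real) \<Rightarrow> nat \<Rightarrow> real) \<Rightarrow> bool" where
  "smooth_euclidean m U n V f \<longleftrightarrow>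
     openin (Euclidean_space m) U \<and> openin (Euclidean_space n) V \<and>
     f \<in> U \<rightarrow> V \<and> (\<forall>j<n. smooth_function m U (\<lambda>x. f x j))"

section \<open>Diffeological spaces\<close>

text \<open>
  \<open>plot X n U p\<close> says that p, restricted to the open subset U of n-dimensional Euclidean space,
  is a plot of X. Functions are total, so the values of p outside U must not matter; this is the
  purpose of the second condition below.
\<close>

record 'a diff_space = "'a partial_object" +
  plot :: "nat \<Rightarrow> (nat \<Rightarrow> real) set \<Rightarrow> ((nat \<Rightarrow> real) \<Rightarrow> 'a) \<Rightarrow> bool"

definition diffeological_space :: "'a diff_space \<Rightarrow> bool" where
  "diffeological_space X \<longleftrightarrow>
     (\<forall>n U p. plot X n U p \<longrightarrow> openin (Euclidean_space n) U \<and> p \<in> U \<rightarrow> carrier X) \<and>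
     (\<forall>n U p q. plot X n U p \<and> (\<forall>u\<in>U. q u = p u) \<longrightarrow> plot X n U q) \<and>
     (\<forall>n U c. openin (Euclidean_space n) U \<and> c \<in> carrier X \<longrightarrow> plot X n U (\<lambda>_. c)) \<and>
     (\<forall>m V n U p f. plot X n U p \<and> smooth_euclidean m V n U f \<longrightarrow> plot X m V (p \<circ> f)) \<and>
     (\<forall>n U p. openin (Euclidean_space n) U \<and> p \<in> U \<rightarrow> carrier X \<and>
        (\<forall>u\<in>U. \<exists>V. openin (Euclidean_space n) V \<and> u \<in> V \<and> V \<subseteq> U \<and> plot X n V p)
        \<longrightarrow> plot X n U p)"

lemma plot_domain:
  assumes "diffeological_space X" "plot X n U p"
  shows "openin (Euclidean_space n) U" "p \<in> U \<rightarrow> carrier X"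
  using assms(1)[unfolded diffeological_space_def, THEN conjunct1, rule_format, OF assms(2)]
  by simp_all

definition smooth_map :: "'a diff_space \<Rightarrow> 'b diff_space \<Rightarrow> ('a \<Rightarrow> 'b) \<Rightarrow> bool" where
  "smooth_map X Y f \<longleftrightarrow>
     f \<in> carrier X \<rightarrow> carrier Y \<and> (\<forall>n U p. plot X n U p \<longrightarrow> plot Y n U (f \<circ> p))"

definition diffeo :: "'a diff_space \<Rightarrow> 'b diff_space \<Rightarrow> ('a \<Rightarrow> 'b) \<Rightarrow> bool" where
  "diffeo X Y f \<longleftrightarrow> smooth_map X Y f \<and>
     (\<exists>g. smooth_map Y X g \<and> (\<forall>x\<in>carrier X. g (f x) = x) \<and> (\<forall>y\<in>carrier Y. f (g y) = y))"

definition subset_space :: "'a diff_space \<Rightarrow> 'a set \<Rightarrow> 'a diff_space" where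
  "subset_space X A = \<lparr>carrier = carrier X \<inter> A, plot = \<lambda>n U p. plot X n U p \<and> p \<in> U \<rightarrow> A\<rparr>"

definition prod_space :: "'a diff_space \<Rightarrow> 'b diff_space \<Rightarrow> ('a \<times> 'b) diff_space" where
  "prod_space X Y = \<lparr>carrier = carrier X \<times> carrier Y,
     plot = \<lambda>n U p. plot X n U (fst \<circ> p) \<and> plot Y n U (snd \<circ> p)\<rparr>"

definition euclidean_open :: "nat \<Rightarrow> (nat \<Rightarrow> real) set \<Rightarrow> (nat \<Rightarrow> real) diff_space" where
  "euclidean_open n U = \<lparr>carrier = U, plot = \<lambda>m V f. smooth_euclidean m V n U f\<rparr>"

definition real_space :: "real diff_space" where
  "real_space = \<lparr>carrier = UNIV, plot = smooth_function\<rparr>"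

definition unit_interval :: "real diff_space" where
  "unit_interval = subset_space real_space {0..1}"

subsection \<open>The D-topology\<close>

definition D_open :: "'a diff_space \<Rightarrow> 'a set \<Rightarrow> bool" where
  "D_open X W \<longleftrightarrow> W \<subseteq> carrier X \<and>
     (\<forall>n U p. plot X n U p \<longrightarrow> openin (Euclidean_space n) {u \<in> U. p u \<in> W})"

definition D_topology :: "'a diff_space \<Rightarrow> 'a topology" where
  "D_topology X = topology (D_open X)"

lemma istopology_D_open: "istopology (D_open X)"
proof -
  have "D_open X (S \<inter> T)" if "D_open X S" "D_open X T" for S T
  proof -
    have "{u \<in> U. p u \<in> S \<inter> T} = {u \<in> U. p u \<in> S} \<inter> {u \<in> U. p u \<in> T}" for U and p :: "(nat \<Rightarrow> real) \<Rightarrow> 'a"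
      by auto
    then show ?thesis
      using that unfolding D_open_def by (auto intro: openin_Int)
  qed
  moreover have "D_open X (\<Union>K)" if "\<forall>S\<in>K. D_open X S" for K
  proof -
    have "{u \<in> U. p u \<in> \<Union>K} = (\<Union>S\<in>K. {u \<in> U. p u \<in> S})" for U and p :: "(nat \<Rightarrow> real) \<Rightarrow> 'a"
      by auto
    then show ?thesis
      using that unfolding D_open_def by (auto intro!: openin_Union)
  qed
  ultimately show ?thesis
    unfolding istopology_def by blast
qed

lemma openin_D_topology: "openin (D_topology X) = D_open X"
  by (simp add: D_topology_def istopology_D_open topology_inverse')

lemma topspace_D_topology:
  assumes "diffeological_space X"
  shows "topspace (D_topology X) = carrier X"
proof (rule antisym)
  show "topspace (D_topology X) \<subseteq> carrier X"
    using openin_topspace[of "D_topology X"] by (simp add: openin_D_topology D_open_def)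
  have "openin (Euclidean_space n) {u \<in> U. p u \<in> carrier X}" if "plot X n U p" for n U p
  proof -
    have "{u \<in> U. p u \<in> carrier X} = U"
      using plot_domain(2)[OF assms that] by auto
    then show ?thesis
      using plot_domain(1)[OF assms that] by simp
  qed
  then have "D_open X (carrier X)"
    by (simp add: D_open_def)
  then show "carrier X \<subseteq> topspace (D_topology X)"
    using openin_subset[of "D_topology X"] by (simp add: openin_D_topology)
qed

lemma D_topology_plot_continuous:
  assumes "diffeological_space X" "plot X n U p"
  shows "continuous_map (subtopology (Euclidean_space n) U) (D_topology X) p"
proof -
  note U = plot_domain[OF assms]
  have top: "topspace (subtopology (Euclidean_space n) U) = U"
    using openin_subset[OF U(1)] by auto
  show ?thesis
    unfolding continuous_map_def top topspace_D_topology[OF assms(1)]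
    using U assms(2) by (auto simp: openin_D_topology D_open_def openin_open_subtopology)
qed

lemma D_topology_finest:
  assumes "diffeological_space X" "topspace T = carrier X"
    and "\<And>n U p. plot X n U p \<Longrightarrow> continuous_map (subtopology (Euclidean_space n) U) T p"
    and "openin T W"
  shows "openin (D_topology X) W"
proof -
  have "openin (Euclidean_space n) {u \<in> U. p u \<in> W}" if p: "plot X n U p" for n U p
  proof -
    have U: "openin (Euclidean_space n) U"
      by (rule plot_domain(1)[OF assms(1) p])
    then have "topspace (subtopology (Euclidean_space n) U) = U"
      using openin_subset by auto
    then have "openin (subtopology (Euclidean_space n) U) {u \<in> U. p u \<in> W}"
      using openin_continuous_map_preimage[OF assms(3)[OF p] assms(4)] by simp
    then show ?thesis
      using U by (simp add: openin_open_subtopology)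
  qed
  then show ?thesis
    using openin_subset[OF assms(4)] assms(2) by (simp add: openin_D_topology D_open_def)
qed

definition open_cover :: "'a topology \<Rightarrow> 'a set set \<Rightarrow> bool" where
  "open_cover T \<U> \<longleftrightarrow> (\<forall>U\<in>\<U>. openin T U) \<and> \<Union>\<U> = topspace T"

definition paracompact_space :: "'a topology \<Rightarrow> bool" where
  "paracompact_space T \<longleftrightarrow>
     (\<forall>\<U>. open_cover T \<U> \<longrightarrow>
        (\<exists>\<V>. open_cover T \<V> \<and> (\<forall>V\<in>\<V>. \<exists>U\<in>\<U>. V \<subseteq> U) \<and> locally_finite_in T \<V>))"

definition pointwise_finite_smooth_partition ::
  "'a diff_space \<Rightarrow> 'i set \<Rightarrow> ('i \<Rightarrow> 'a \<Rightarrow> real) \<Rightarrow> bool" where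
  "pointwise_finite_smooth_partition X I \<zeta> \<longleftrightarrow>
     (\<forall>i\<in>I. smooth_map X unit_interval (\<zeta> i)) \<and>
     (\<forall>x\<in>carrier X. finite {i\<in>I. \<zeta> i x \<noteq> 0} \<and> (\<Sum>i\<in>{i\<in>I. \<zeta> i x \<noteq> 0}. \<zeta> i x) = 1)"

text \<open>
  The partition of unity is indexed by the members of the cover; closed supports form a
  locally finite family, and each is contained in the corresponding member.
\<close>

definition subordinate_smooth_partition ::
  "'a diff_space \<Rightarrow> 'a set set \<Rightarrow> ('a set \<Rightarrow> 'a \<Rightarrow> real) \<Rightarrow> bool" where
  "subordinate_smooth_partition X \<U> \<zeta> \<longleftrightarrow>
     pointwise_finite_smooth_partition X \<U> \<zeta> \<and>
     (\<forall>U\<in>\<U>. D_topology X closure_of {x\<in>carrier X. \<zeta> U x \<noteq> 0} \<subseteq> U) \<and>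
     (\<forall>x\<in>carrier X. \<exists>W. openin (D_topology X) W \<and> x \<in> W \<and>
        finite {U\<in>\<U>. W \<inter> D_topology X closure_of {y\<in>carrier X. \<zeta> U y \<noteq> 0} \<noteq> {}})"

definition smoothly_paracompact :: "'a diff_space \<Rightarrow> bool" where
  "smoothly_paracompact X \<longleftrightarrow>
     paracompact_space (D_topology X) \<and>
     (\<forall>\<U>. open_cover (D_topology X) \<U> \<longrightarrow> (\<exists>\<zeta>. subordinate_smooth_partition X \<U> \<zeta>))"

definition smooth_strong_deformation_retraction ::
  "'a diff_space \<Rightarrow> 'a set \<Rightarrow> ('a \<times> real \<Rightarrow> 'a) \<Rightarrow> bool" where
  "smooth_strong_deformation_retraction Y A \<Phi> \<longleftrightarrow>
     A \<subseteq> carrier Y \<and>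
     smooth_map (prod_space Y unit_interval) Y \<Phi> \<and>
     (\<forall>y\<in>carrier Y. \<Phi> (y, 1) = y) \<and>
     \<Phi> ` (carrier Y \<times> {0}) \<subseteq> A \<and>
     (\<forall>a\<in>A. \<forall>\<tau>\<in>{0..1}. \<Phi> (a, \<tau>) = a)"

section \<open>Diffeological groups and bundles\<close>

text \<open>A diffeological group is a group G together with a diffeology D on its carrier.\<close>

definition diffeological_group :: "('g, 'm) monoid_scheme \<Rightarrow> 'g diff_space \<Rightarrow> bool" where
  "diffeological_group G D \<longleftrightarrow>
     group G \<and> diffeological_space D \<and> carrier D = carrier G \<and>
     smooth_map (prod_space D D) D (\<lambda>(g, h). g \<otimes>\<^bsub>G\<^esub> h) \<and>
     smooth_map D D (\<lambda>g. inv\<^bsub>G\<^esub> g)"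

definition pullback ::
  "'y diff_space \<Rightarrow> ('y \<Rightarrow> 'x) \<Rightarrow> 'e diff_space \<Rightarrow> ('e \<Rightarrow> 'x) \<Rightarrow> ('y \<times> 'e) diff_space" where
  "pullback Y f E \<pi> = subset_space (prod_space Y E) {(y, e). f y = \<pi> e}"

definition trivial_bundle ::
  "'e diff_space \<Rightarrow> 'x diff_space \<Rightarrow> ('e \<Rightarrow> 'x) \<Rightarrow> 'f diff_space \<Rightarrow> bool" where
  "trivial_bundle E X \<pi> F \<longleftrightarrow>
     (\<exists>\<psi>. diffeo E (prod_space X F) \<psi> \<and> (\<forall>e\<in>carrier E. fst (\<psi> e) = \<pi> e))"

text \<open>
  A fibre of a trivial bundle over a nonempty base is diffeomorphic to a subspace of the total
  space, so it is no restriction that F below has the same type of points as E.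
\<close>

definition local_trivialisation ::
  "'e diff_space \<Rightarrow> 'x diff_space \<Rightarrow> ('e \<Rightarrow> 'x) \<Rightarrow> 'x set set \<Rightarrow> bool" where
  "local_trivialisation E X \<pi> \<U> \<longleftrightarrow>
     open_cover (D_topology X) \<U> \<and>
     (\<forall>U\<in>\<U>. \<exists>F :: 'e diff_space. diffeological_space F \<and>
        trivial_bundle (subset_space E {e. \<pi> e \<in> U}) (subset_space X U) \<pi> F)"

definition fibre_bundle :: "'e diff_space \<Rightarrow> 'x diff_space \<Rightarrow> ('e \<Rightarrow> 'x) \<Rightarrow> bool" where
  "fibre_bundle E X \<pi> \<longleftrightarrow>
     diffeological_space E \<and> diffeological_space X \<and>
     smooth_map E X \<pi> \<and> \<pi> ` carrier E = carrier X \<and>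
     (\<forall>n U p. plot X n U p \<longrightarrow>
        (\<exists>\<U>. local_trivialisation (pullback (euclidean_open n U) p E \<pi>) (euclidean_open n U) fst \<U>))"

text \<open>
  The library's group actions are by extensional functions, hence the restriction. An action on E
  can thus be reused, as it stands, as an action of a subgroup on an invariant subspace.
\<close>

definition smooth_action ::
  "('g, 'm) monoid_scheme \<Rightarrow> 'g diff_space \<Rightarrow> 'e diff_space \<Rightarrow> ('g \<Rightarrow> 'e \<Rightarrow> 'e) \<Rightarrow> bool" where
  "smooth_action G D E act \<longleftrightarrow>
     group_action G (carrier E) (\<lambda>g. restrict (act g) (carrier E)) \<and>
     smooth_map (prod_space D E) E (\<lambda>(g, e). act g e)"

definition equivariant ::
  "('g, 'm) monoid_scheme \<Rightarrow> 'y diff_space \<Rightarrow> ('g \<Rightarrow> 'y \<Rightarrow> 'y) \<Rightarrow> ('g \<Rightarrow> 'z \<Rightarrow> 'z) \<Rightarrow> ('y \<Rightarrow> 'z) \<Rightarrow> bool" where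
  "equivariant G Y act act' f \<longleftrightarrow>
     (\<forall>g\<in>carrier G. \<forall>y\<in>carrier Y. f (act g y) = act' g (f y))"

definition principal_bundle ::
  "('g, 'm) monoid_scheme \<Rightarrow> 'g diff_space \<Rightarrow> 'e diff_space \<Rightarrow> 'x diff_space \<Rightarrow> ('e \<Rightarrow> 'x)
     \<Rightarrow> ('g \<Rightarrow> 'e \<Rightarrow> 'e) \<Rightarrow> bool" where
  "principal_bundle G D E X \<pi> act \<longleftrightarrow>
     diffeological_group G D \<and> fibre_bundle E X \<pi> \<and> smooth_action G D E act \<and>
     (\<forall>n U p u. plot X n U p \<and> u \<in> U \<longrightarrow>
        (\<exists>V q. openin (Euclidean_space n) V \<and> u \<in> V \<and> V \<subseteq> U \<and>
           plot E n V q \<and> (\<forall>v\<in>V. \<pi> (q v) = p v) \<and>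
           diffeo (prod_space (euclidean_open n V) D) (pullback (euclidean_open n V) p E \<pi>)
             (\<lambda>(v, g). (v, act g (q v))) \<and>
           equivariant G (prod_space (euclidean_open n V) D)
             (\<lambda>h (v, g). (v, h \<otimes>\<^bsub>G\<^esub> g)) (\<lambda>h (v, e). (v, act h e))
             (\<lambda>(v, g). (v, act g (q v)))))"

definition weakly_D_numerable ::
  "'e diff_space \<Rightarrow> 'x diff_space \<Rightarrow> ('e \<Rightarrow> 'x) \<Rightarrow> bool" where
  "weakly_D_numerable E X \<pi> \<longleftrightarrow>
     (\<exists>(U :: nat \<Rightarrow> 'x set) \<zeta>. local_trivialisation E X \<pi> (range U) \<and>
        pointwise_finite_smooth_partition X UNIV \<zeta> \<and>
        (\<forall>i. {x\<in>carrier X. \<zeta> i x \<in> {0<..1}} \<subseteq> U i))"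

definition principal_bundle_iso ::
  "('g, 'm) monoid_scheme \<Rightarrow> 'e diff_space \<Rightarrow> ('e \<Rightarrow> 'x) \<Rightarrow> ('g \<Rightarrow> 'e \<Rightarrow> 'e)
     \<Rightarrow> 'd diff_space \<Rightarrow> ('d \<Rightarrow> 'x) \<Rightarrow> ('g \<Rightarrow> 'd \<Rightarrow> 'd) \<Rightarrow> ('e \<Rightarrow> 'd) \<Rightarrow> bool" where
  "principal_bundle_iso G E \<pi> act E' \<pi>' act' f \<longleftrightarrow>
     diffeo E E' f \<and> (\<forall>e\<in>carrier E. \<pi>' (f e) = \<pi> e) \<and> equivariant G E act act' f"

end

theory Submission
  imports Defs
begin

text \<open>
  No classifying space is needed: E itself retracts, with \<open>f\<close> the identity. Write \<open>r\<^sub>\<tau> = \<Phi>(-, \<tau>)\<close> and let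
  K be the kernel of \<open>r\<^sub>0\<close>, on which G acts by \<open>g \<cdot> k = g k r\<^sub>0(g)\<inverse>\<close>. An equivariant smooth map
  \<open>s : E \<rightarrow> K\<close> yields the principal H-bundle \<open>P = s\<inverse>(1)\<close> and the retraction
  \<open>\<Psi>(e, \<tau>) = r\<^sub>\<tau>(s(e)) s(e)\<inverse> e\<close>.

  A local section q of E gives the equivariant map \<open>e \<mapsto> t r\<^sub>0(t)\<inverse>\<close>, where \<open>t q(\<pi>(e)) = e\<close>. Two equivariant
  maps a, b are joined by the path \<open>\<tau> \<mapsto> a c\<^sub>\<tau>(a\<inverse> b)\<close>, where \<open>c\<^sub>\<tau>(k) = r\<^sub>\<tau>(k) r\<^sub>0(r\<^sub>\<tau>(k))\<inverse>\<close> contracts K and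
  commutes with conjugation by H. Following these paths with a smooth step function of \<open>\<zeta>\<^sub>n\<close> against
  \<open>\<sigma>\<^sub>n = \<zeta>\<^sub>0 + \<dots> + \<zeta>\<^sub>n\<^sub>-\<^sub>1\<close>, the local maps are patched one after the other. Where \<open>\<sigma>\<^sub>N > 3/4\<close> every later
  \<open>\<zeta>\<^sub>n\<close> is below \<open>1/4\<close>, so the patching is stationary there, although the partition is only pointwise
  finite.
\<close>

section \<open>Calculus of smooth functions\<close>

text \<open>
  Unlike \<^const>\<open>C_class\<close>, which does not demand continuity of the lower derivatives, the classes
  below decrease in k by definition. This is what makes the product rule provable by induction.
\<close>

primrec Ck :: "nat \<Rightarrow> nat \<Rightarrow> (nat \<Rightarrow> real) set \<Rightarrow> ((nat \<Rightarrow> real) \<Rightarrow> real) \<Rightarrow> bool" where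
  "Ck 0 n U f \<longleftrightarrow> continuous_on U f"
| "Ck (Suc k) n U f \<longleftrightarrow> continuous_on U f \<and>
     (\<exists>D. \<forall>i<n. (\<forall>x\<in>U. ((\<lambda>t. f (x(i := t))) has_real_derivative D i x) (at (x i))) \<and> Ck k n U (D i))"

lemma Ck_continuous: "Ck k n U f \<Longrightarrow> continuous_on U f"
  by (cases k) auto

lemma Ck_SucI:
  assumes "continuous_on U f"
    and "\<And>i x. i < n \<Longrightarrow> x \<in> U \<Longrightarrow> ((\<lambda>t. f (x(i := t))) has_real_derivative D i x) (at (x i))"
    and "\<And>i. i < n \<Longrightarrow> Ck k n U (D i)"
  shows "Ck (Suc k) n U f"
  using assms by auto

lemma Ck_Suc_imp: "Ck (Suc k) n U f \<Longrightarrow> Ck k n U f"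
proof (induction k arbitrary: f)
  case (Suc k)
  then obtain D where D: "\<forall>i<n. (\<forall>x\<in>U. ((\<lambda>t. f (x(i := t))) has_real_derivative D i x) (at (x i)))
      \<and> Ck (Suc k) n U (D i)"
    by auto
  with Suc.IH have "\<forall>i<n. Ck k n U (D i)"
    by blast
  then show ?case
    using Ck_continuous[OF Suc.prems] D by (intro Ck_SucI[where D = D]) blast+
qed simp

section \<open>Open subsets of Euclidean spaces inside the product topology on sequences\<close>

lemma Euclidean_space_openin_iff:
  "openin (Euclidean_space n) U \<longleftrightarrow> (\<exists>T. open T \<and> U = T \<inter> {x. \<forall>i\<ge>n. x i = 0})"
  unfolding Euclidean_space_def openin_subtopology euclidean_product_topology by auto

text \<open>An open \<open>U\<close> already lies in the set of sequences vanishing from index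
  \<open>n\<close> on, so intersecting with that set changes nothing. This gives access to
  \<open>continuous_on\<close>.\<close>

lemma Euclidean_subtopology:
  assumes "openin (Euclidean_space n) U"
  shows "subtopology (Euclidean_space n) U = top_of_set U"
proof -
  have "U \<subseteq> {x. \<forall>i\<ge>n. x i = 0}"
    using openin_subset[OF assms] by (simp add: topspace_Euclidean_space)
  then show ?thesis
    unfolding Euclidean_space_def euclidean_product_topology subtopology_subtopology
    by (simp add: Int_absorb1)
qed

lemma continuous_map_Euclidean_open_iff:
  "openin (Euclidean_space n) U \<Longrightarrow>
    continuous_map (subtopology (Euclidean_space n) U) euclideanreal f \<longleftrightarrow> continuous_on U f"
  by (simp add: Euclidean_subtopology)

text \<open>Changing a coordinate below \<open>n\<close> keeps the later ones zero, so only the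
  ambient open set has to be met. Hence partial derivatives at points of \<open>U\<close> see only
  values of the function on \<open>U\<close>.\<close>

lemma eventually_coordinate_in:
  assumes "openin (Euclidean_space n) U" "x \<in> U" "i < n"
  shows "\<forall>\<^sub>F t in nhds (x i). x(i := t) \<in> U"
proof -
  obtain T where T: "open T" "U = T \<inter> {x. \<forall>i\<ge>n. x i = 0}"
    using assms(1) unfolding Euclidean_space_openin_iff by blast
  have "continuous_on UNIV (\<lambda>t. x(i := t))"
  proof (rule continuous_on_coordinatewise_then_product)
    show "continuous_on UNIV (\<lambda>t. (x(i := t)) j)" for j
      by (cases "j = i") auto
  qed
  then have "open ((\<lambda>t. x(i := t)) -` T)"
    using T(1) open_vimage by blast
  moreover have "x i \<in> (\<lambda>t. x(i := t)) -` T"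
    using assms(2) T by simp
  ultimately have "\<forall>\<^sub>F t in nhds (x i). x(i := t) \<in> T"
    unfolding eventually_nhds by (metis vimageE)
  then show ?thesis
    using assms T by (auto elim!: eventually_mono)
qed

text \<open>The derivatives \<open>D\<close> of \<open>f\<close> serve unchanged for
  \<open>g\<close>, because along each coordinate line the two functions agree near the point. A
  case distinction on \<open>k\<close> therefore suffices.\<close>

lemma C_class_cong:
  assumes "openin (Euclidean_space n) U" "\<And>x. x \<in> U \<Longrightarrow> f x = g x" "C_class k n U f"
  shows "C_class k n U g"
proof (cases k)
  case 0
  then show ?thesis
    using assms continuous_on_cong[of U U f g] by (simp add: continuous_map_Euclidean_open_iff)
next
  case (Suc l)
  obtain D where D: "\<And>i. i<n \<Longrightarrow> (\<forall>x\<in>U. ((\<lambda>t. f (x(i := t))) has_real_derivative D i x) (at (x i)))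
      \<and> C_class l n U (D i)"
    using assms(3) Suc by auto
  have "((\<lambda>t. g (x(i := t))) has_real_derivative D i x) (at (x i))" if "i < n" "x \<in> U" for i x
  proof -
    have ev: "\<forall>\<^sub>F t in nhds (x i). f (x(i := t)) = g (x(i := t))"
      using eventually_coordinate_in[OF assms(1) that(2,1)] assms(2) by (auto elim: eventually_mono)
    show ?thesis
      using D[OF that(1)] that(2) DERIV_cong_ev[OF refl ev refl] by blast
  qed
  then show ?thesis
    using D Suc by auto
qed

lemma Ck_imp_C_class:
  "openin (Euclidean_space n) U \<Longrightarrow> Ck k n U f \<Longrightarrow> C_class k n U f"
proof (induction k arbitrary: f)
  case 0
  then show ?case by (simp add: continuous_map_Euclidean_open_iff)
next
  case (Suc k)
  then obtain D where D: "\<forall>i<n. (\<forall>x\<in>U. ((\<lambda>t. f (x(i := t))) has_real_derivative D i x) (at (x i)))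
      \<and> Ck k n U (D i)"
    by auto
  with Suc have "\<forall>i<n. C_class k n U (D i)"
    by blast
  with D show ?case
    by auto
qed

text \<open>All classes up to \<open>k\<close> are assumed, since a single \<open>C_class\<close>
  gives no continuity below the top order. Each class comes with its own choice of derivatives, and
  these choices must be reconciled.\<close>

lemma C_class_imp_Ck:
  assumes "openin (Euclidean_space n) U"
  shows "(\<And>j. j \<le> k \<Longrightarrow> C_class j n U f) \<Longrightarrow> Ck k n U f"
proof (induction k arbitrary: f)
  case 0
  from 0[of 0] show ?case using assms by (simp add: continuous_map_Euclidean_open_iff)
next
  case (Suc k)
  have "continuous_on U f"
    using Suc.prems[of 0] assms by (simp add: continuous_map_Euclidean_open_iff)
  moreover obtain D where D: "\<And>i. i<n \<Longrightarrow> (\<forall>x\<in>U. ((\<lambda>t. f (x(i := t))) has_real_derivative D i x) (at (x i)))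
      \<and> C_class k n U (D i)"
    using Suc.prems[of "Suc k"] by auto
  moreover have "Ck k n U (D i)" if i: "i < n" for i
  proof (rule Suc.IH)
    fix j assume "j \<le> k"
    then have "C_class (Suc j) n U f"
      by (intro Suc.prems) simp
    then obtain D' where D': "\<And>i. i<n \<Longrightarrow> (\<forall>x\<in>U. ((\<lambda>t. f (x(i := t))) has_real_derivative D' i x) (at (x i)))
      \<and> C_class j n U (D' i)"
      by auto
    \<comment> \<open>Uniqueness of derivatives identifies the choices, though only on
      \<open>U\<close>; \<open>C_class_cong\<close> then transfers the class.\<close>
    have "D' i x = D i x" if "x \<in> U" for x
      using D[OF i] D'[OF i] that DERIV_unique[of "\<lambda>t. f (x(i := t))"] by blast
    then show "C_class j n U (D i)"
      using C_class_cong[OF assms] D'[OF i] by blast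
  qed
  ultimately show ?case
    by auto
qed

lemma smooth_function_iff_Ck:
  "smooth_function n U f \<longleftrightarrow> openin (Euclidean_space n) U \<and> (\<forall>k. Ck k n U f)"
  unfolding smooth_function_def using Ck_imp_C_class C_class_imp_Ck by metis

section \<open>Closure of the classes under arithmetic operations\<close>

lemma Ck_const: "Ck k n U (\<lambda>x. c)"
  by (induction k arbitrary: c) (auto intro!: exI[of _ "\<lambda>_ _. 0"])

lemma Ck_coordinate: "Ck k n U (\<lambda>x. x j)"
proof (cases k)
  case (Suc l)
  have "continuous_on U (\<lambda>x :: nat \<Rightarrow> real. x j)"
    by (rule continuous_on_product_then_coordinatewise) (rule continuous_on_id)
  then show ?thesis
    unfolding Suc by (rule Ck_SucI[where D = "\<lambda>i _. if i = j then 1 else 0"]) (auto simp: Ck_const)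
qed (auto intro: continuous_on_product_then_coordinatewise)

lemma Ck_add: "Ck k n U f \<Longrightarrow> Ck k n U g \<Longrightarrow> Ck k n U (\<lambda>x. f x + g x)"
proof (induction k arbitrary: f g)
  case (Suc k)
  from Suc.prems(1) obtain Df where Df:
    "\<And>i x. i<n \<Longrightarrow> x\<in>U \<Longrightarrow> ((\<lambda>t. f (x(i := t))) has_real_derivative Df i x) (at (x i))"
    "\<And>i. i<n \<Longrightarrow> Ck k n U (Df i)" by auto
  from Suc.prems(2) obtain Dg where Dg:
    "\<And>i x. i<n \<Longrightarrow> x\<in>U \<Longrightarrow> ((\<lambda>t. g (x(i := t))) has_real_derivative Dg i x) (at (x i))"
    "\<And>i. i<n \<Longrightarrow> Ck k n U (Dg i)" by auto
  show ?case
    using Suc.prems Df Dg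
    by (intro Ck_SucI[where D = "\<lambda>i x. Df i x + Dg i x"] Suc.IH DERIV_add continuous_on_add)
      (auto simp del: fun_upd_apply)
qed (auto intro: continuous_intros)

text \<open>The product rule mixes derivatives with the undifferentiated factors, whose class must
  first be lowered by \<open>Ck_Suc_imp\<close> before the induction hypothesis applies.\<close>

lemma Ck_mult: "Ck k n U f \<Longrightarrow> Ck k n U g \<Longrightarrow> Ck k n U (\<lambda>x. f x * g x)"
proof (induction k arbitrary: f g)
  case (Suc k)
  from Suc.prems(1) obtain Df where Df:
    "\<And>i x. i<n \<Longrightarrow> x\<in>U \<Longrightarrow> ((\<lambda>t. f (x(i := t))) has_real_derivative Df i x) (at (x i))"
    "\<And>i. i<n \<Longrightarrow> Ck k n U (Df i)" by auto
  from Suc.prems(2) obtain Dg where Dg: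
    "\<And>i x. i<n \<Longrightarrow> x\<in>U \<Longrightarrow> ((\<lambda>t. g (x(i := t))) has_real_derivative Dg i x) (at (x i))"
    "\<And>i. i<n \<Longrightarrow> Ck k n U (Dg i)" by auto
  show ?case
  proof (rule Ck_SucI[where D = "\<lambda>i x. Df i x * g x + Dg i x * f x"])
    show "continuous_on U (\<lambda>x. f x * g x)"
      using Suc.prems by (auto intro!: continuous_intros)
    show "((\<lambda>t. f (x(i := t)) * g (x(i := t))) has_real_derivative Df i x * g x + Dg i x * f x) (at (x i))"
      if "i < n" "x \<in> U" for i x
      using DERIV_mult[OF Df(1)[OF that] Dg(1)[OF that]] by simp
    show "Ck k n U (\<lambda>x. Df i x * g x + Dg i x * f x)" if "i < n" for i
      using Suc Df(2)[OF that] Dg(2)[OF that] Ck_Suc_imp by (intro Ck_add Suc.IH) blast+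
  qed
qed (auto intro: continuous_intros)

lemma Ck_cmult: "Ck k n U f \<Longrightarrow> Ck k n U (\<lambda>x. c * f x)"
  by (intro Ck_mult Ck_const)

lemma Ck_diff: "Ck k n U f \<Longrightarrow> Ck k n U g \<Longrightarrow> Ck k n U (\<lambda>x. f x - g x)"
  using Ck_add[of k n U f "\<lambda>x. (-1) * g x"] Ck_cmult[of k n U g "-1"] by simp

lemma Ck_sum: "(\<And>i. i \<in> I \<Longrightarrow> Ck k n U (f i)) \<Longrightarrow> Ck k n U (\<lambda>x. \<Sum>i\<in>I. f i x)"
  by (induction I rule: infinite_finite_induct) (auto intro: Ck_const Ck_add)

text \<open>The derivative contains \<open>inverse (f x)\<close> again, one class lower, so the
  induction hypothesis for the same \<open>f\<close> covers it.\<close>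

lemma Ck_inverse:
  "Ck k n U f \<Longrightarrow> (\<And>x. x \<in> U \<Longrightarrow> f x \<noteq> 0) \<Longrightarrow> Ck k n U (\<lambda>x. inverse (f x))"
proof (induction k arbitrary: f)
  case (Suc k)
  from Suc.prems(1) obtain D where D:
    "\<And>i x. i<n \<Longrightarrow> x\<in>U \<Longrightarrow> ((\<lambda>t. f (x(i := t))) has_real_derivative D i x) (at (x i))"
    "\<And>i. i<n \<Longrightarrow> Ck k n U (D i)" by auto
  have IH: "Ck k n U (\<lambda>x. inverse (f x))"
    using Suc Ck_Suc_imp by blast
  show ?case
  proof (rule Ck_SucI[where D = "\<lambda>i x. (-1) * (inverse (f x) * D i x * inverse (f x))"])
    show "continuous_on U (\<lambda>x. inverse (f x))"
      using Suc.prems by (auto intro!: continuous_intros)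
    show "((\<lambda>t. inverse (f (x(i := t)))) has_real_derivative
        (-1) * (inverse (f x) * D i x * inverse (f x))) (at (x i))" if "i < n" "x \<in> U" for i x
      using DERIV_inverse'[OF D(1)[OF that]] Suc.prems(2) that by simp
    show "Ck k n U (\<lambda>x. (-1) * (inverse (f x) * D i x * inverse (f x)))" if "i < n" for i
      using IH D(2)[OF that] by (intro Ck_mult Ck_const)
  qed
qed (auto intro: continuous_intros)

section \<open>Flat functions at the origin and a smooth step function\<close>

definition flat :: "nat \<Rightarrow> real \<Rightarrow> real" where
  "flat k t = (if t > 0 then inverse t ^ k * exp (- inverse t) else 0)"

text \<open>From the right, substituting the inverse of \<open>t\<close> reduces the claim to
  exponential growth beating every power; from the left the function is zero.\<close>

lemma flat_at_0: "(flat k \<longlongrightarrow> 0) (at 0)"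
proof -
  have "((\<lambda>t. inverse t ^ k / exp (inverse t)) \<longlongrightarrow> 0) (at_right (0::real))"
    using filterlim_compose[OF tendsto_power_div_exp_0 filterlim_inverse_at_top_right] .
  then have "(flat k \<longlongrightarrow> 0) (at_right 0)"
    by (rule Lim_transform_eventually)
      (auto simp: flat_def eventually_at_right_field exp_minus divide_inverse intro: exI[of _ 1])
  moreover have "(flat k \<longlongrightarrow> 0) (at_left 0)"
    by (rule tendsto_eventually) (auto simp: flat_def eventually_at_left_field intro: exI[of _ "-1"])
  ultimately show ?thesis
    using filterlim_split_at by blast
qed

text \<open>The index \<open>k\<close> exists for this formula: the family is closed under
  differentiation up to linear combinations, which a single flat function is not.\<close>

lemma flat_deriv:
  "(flat k has_real_derivative flat (k + 2) t - real k * flat (k + 1) t) (at t)"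
proof -
  consider "t > 0" | "t < 0" | "t = 0" by linarith
  then show ?thesis
  proof cases
    case 1
    have "((\<lambda>t. inverse t ^ k * exp (- inverse t)) has_real_derivative
        flat (k + 2) t - real k * flat (k + 1) t) (at t)"
    proof (cases k)
      case 0
      then show ?thesis
        using 1 by (auto intro!: derivative_eq_intros simp: flat_def power2_eq_square divide_inverse)
    next
      case (Suc m)
      have inv: "(inverse has_real_derivative - (inverse t * inverse t)) (at t)"
        using 1 by (auto intro!: derivative_eq_intros)
      have "((\<lambda>t. exp (- inverse t)) has_real_derivative exp (- inverse t) * (inverse t * inverse t)) (at t)"
        using DERIV_fun_exp[OF DERIV_minus[OF inv]] by simp
      from DERIV_mult[OF DERIV_power_Suc[OF inv, of m] this] show ?thesis
        using 1 by (simp add: Suc flat_def algebra_simps)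
    qed
    moreover have "\<forall>\<^sub>F s in nhds t. inverse s ^ k * exp (- inverse s) = flat k s"
      using eventually_nhds_in_open[of "{0<..}" t] 1 by (auto simp: flat_def elim: eventually_mono)
    ultimately show ?thesis
      by (rule DERIV_cong_ev[OF refl _ refl, THEN iffD1, rotated])
  next
    case 2
    have "\<forall>\<^sub>F s in nhds t. 0 = flat k s"
      using eventually_nhds_in_open[of "{..<0}" t] 2 by (auto simp: flat_def elim: eventually_mono)
    then show ?thesis
      using DERIV_cong_ev[of t t "\<lambda>_. 0" "flat k" 0] 2 by (simp add: flat_def)
  next
    case 3
    \<comment> \<open>The difference quotient at the origin is again a member of the family. The
      equation holds at \<open>h = 0\<close> too, where division by zero yields
      \<open>0\<close>.\<close>
    have "(\<lambda>h. (flat k (0 + h) - flat k 0) / h) = flat (Suc k)"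
      by (auto simp: flat_def fun_eq_iff divide_inverse)
    then have "(flat k has_real_derivative 0) (at 0)"
      unfolding DERIV_def using flat_at_0[of "Suc k"] by simp
    then show ?thesis
      using 3 by (simp add: flat_def)
  qed
qed

lemma continuous_flat: "continuous_on UNIV (flat k)"
  by (rule DERIV_continuous_on) (rule flat_deriv)

text \<open>Differentiation raises the index of \<open>flat\<close>, so \<open>k\<close> has to vary
  in the induction on the class.\<close>

lemma Ck_flat: "Ck l n U f \<Longrightarrow> Ck l n U (\<lambda>x. flat k (f x))"
proof (induction l arbitrary: k)
  case 0
  then show ?case
    using continuous_on_compose2[OF continuous_flat] by simp
next
  case (Suc l)
  from Suc.prems obtain D where D:
    "\<And>i x. i<n \<Longrightarrow> x\<in>U \<Longrightarrow> ((\<lambda>t. f (x(i := t))) has_real_derivative D i x) (at (x i))"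
    "\<And>i. i<n \<Longrightarrow> Ck l n U (D i)" by auto
  have IH: "Ck l n U (\<lambda>x. flat j (f x))" for j
    using Suc Ck_Suc_imp by blast
  show ?case
  proof (rule Ck_SucI[where D = "\<lambda>i x. (flat (k + 2) (f x) - real k * flat (k + 1) (f x)) * D i x"])
    show "continuous_on U (\<lambda>x. flat k (f x))"
      using continuous_on_compose2[OF continuous_flat Ck_continuous[OF Suc.prems]] by simp
    show "((\<lambda>t. flat k (f (x(i := t)))) has_real_derivative
        (flat (k + 2) (f x) - real k * flat (k + 1) (f x)) * D i x) (at (x i))" if "i < n" "x \<in> U" for i x
      using DERIV_chain2[where f = "flat k", OF _ D(1)[OF that]] flat_deriv[of k "f x"] by simp
    show "Ck l n U (\<lambda>x. (flat (k + 2) (f x) - real k * flat (k + 1) (f x)) * D i x)" if "i < n" for i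
      using IH D(2)[OF that] by (intro Ck_mult Ck_diff Ck_cmult)
  qed
qed

text \<open>
  A smooth step in the ratio of a and b, constant near the two axes. At least one of the arguments
  of \<^const>\<open>flat\<close> is positive when a and b are, as they add up to \<open>a + b\<close>.
\<close>

definition blend :: "real \<Rightarrow> real \<Rightarrow> real" where
  "blend a b = flat 0 (2 * a - b) * inverse (flat 0 (2 * a - b) + flat 0 (2 * b - a))"

lemma flat_0_nonneg: "flat 0 t \<ge> 0" and flat_0_pos: "t > 0 \<Longrightarrow> flat 0 t > 0"
  by (auto simp: flat_def)

lemma blend_in_unit: "blend a b \<in> {0..1}"
  unfolding blend_def divide_inverse[symmetric] using flat_0_nonneg[of "2 * a - b"] flat_0_nonneg[of "2 * b - a"]
  by (auto simp: divide_le_eq_1)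

lemma blend_eq_0: "2 * a \<le> b \<Longrightarrow> blend a b = 0"
  by (simp add: blend_def flat_def)

text \<open>The second summand of the denominator vanishes, and positivity of \<open>a\<close> and
  \<open>b\<close> keeps the first one nonzero, so the quotient really is \<open>1\<close>.\<close>

lemma blend_eq_1: "2 * b \<le> a \<Longrightarrow> 0 < a \<Longrightarrow> 0 < b \<Longrightarrow> blend a b = 1"
  by (simp add: blend_def flat_def)

lemma smooth_function_blend:
  assumes "smooth_function n U f" "smooth_function n U g" "\<And>x. x \<in> U \<Longrightarrow> f x > 0 \<and> g x > 0"
  shows "smooth_function n U (\<lambda>x. blend (f x) (g x))"
proof -
  have "flat 0 (2 * f x - g x) + flat 0 (2 * g x - f x) \<noteq> 0" if "x \<in> U" for x
  proof -
    have "2 * f x - g x > 0 \<or> 2 * g x - f x > 0"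
      using assms(3)[OF that] by linarith
    then have "flat 0 (2 * f x - g x) > 0 \<or> flat 0 (2 * g x - f x) > 0"
      using flat_0_pos by blast
    then show ?thesis
      using flat_0_nonneg[of "2 * f x - g x"] flat_0_nonneg[of "2 * g x - f x"] by linarith
  qed
  then show ?thesis
    using assms(1,2) unfolding smooth_function_iff_Ck blend_def
    by (intro conjI allI Ck_mult[where f = "\<lambda>x. flat 0 (2 * f x - g x)"] Ck_inverse Ck_add Ck_flat Ck_diff
        Ck_cmult) blast+
qed

lemma smooth_function_open_less:
  assumes "smooth_function n U f" "smooth_function n U g"
  shows "openin (Euclidean_space n) {x \<in> U. f x < g x}"
proof -
  have U: "openin (Euclidean_space n) U" and "continuous_on U f" "continuous_on U g"
    using assms Ck_continuous unfolding smooth_function_iff_Ck by blast+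
  then have "continuous_on U (\<lambda>x. g x - f x)"
    by (intro continuous_intros)
  then have "openin (top_of_set U) (U \<inter> (\<lambda>x. g x - f x) -` {0<..})"
    using continuous_openin_preimage_gen[of U "\<lambda>x. g x - f x" "{0<..}"] by simp
  moreover have "U \<inter> (\<lambda>x. g x - f x) -` {0<..} = {x \<in> U. f x < g x}"
    by auto
  ultimately show ?thesis
    by (simp add: openin_open_subtopology[OF U] flip: Euclidean_subtopology[OF U])
qed

lemma smooth_function_const: "openin (Euclidean_space n) U \<Longrightarrow> smooth_function n U (\<lambda>x. c)"
  by (simp add: smooth_function_iff_Ck Ck_const)

lemma smooth_function_sum:
  "openin (Euclidean_space n) U \<Longrightarrow> (\<And>i. i \<in> I \<Longrightarrow> smooth_function n U (f i)) \<Longrightarrow>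
    smooth_function n U (\<lambda>x. \<Sum>i\<in>I. f i x)"
  by (simp add: smooth_function_iff_Ck Ck_sum)

lemma smooth_function_cmult: "smooth_function n U f \<Longrightarrow> smooth_function n U (\<lambda>x. c * f x)"
  by (simp add: smooth_function_iff_Ck Ck_cmult)

lemma smooth_function_coordinate: "openin (Euclidean_space n) U \<Longrightarrow> smooth_function n U (\<lambda>x. x j)"
  by (simp add: smooth_function_iff_Ck Ck_coordinate)

section \<open>Diffeological spaces\<close>

lemma plot_cong:
  assumes "diffeological_space X" "plot X n U p" "\<And>u. u \<in> U \<Longrightarrow> q u = p u"
  shows "plot X n U q"
  using assms(1)[unfolded diffeological_space_def, THEN conjunct2, THEN conjunct1] assms(2,3) by blast

lemma plot_const:
  assumes "diffeological_space X" "openin (Euclidean_space n) U" "c \<in> carrier X"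
  shows "plot X n U (\<lambda>_. c)"
  using assms unfolding diffeological_space_def by blast

lemma plot_compose:
  assumes "diffeological_space X" "plot X n U p" "smooth_euclidean m V n U f"
  shows "plot X m V (\<lambda>v. p (f v))"
proof -
  have "plot X m V (p \<circ> f)"
    using assms unfolding diffeological_space_def by blast
  then show ?thesis
    by (simp add: comp_def)
qed

lemma smooth_euclidean_inclusion:
  assumes "openin (Euclidean_space n) U" "openin (Euclidean_space n) V" "V \<subseteq> U"
  shows "smooth_euclidean n V n U (\<lambda>x. x)"
  using assms by (auto simp: smooth_euclidean_def smooth_function_coordinate)

lemma plot_restrict:
  assumes "diffeological_space X" "plot X n U p" "openin (Euclidean_space n) V" "V \<subseteq> U"
  shows "plot X n V p"
  using plot_compose[OF assms(1,2) smooth_euclidean_inclusion[OF plot_domain(1)[OF assms(1,2)] assms(3,4)]] .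

text \<open>Combines the sheaf axiom with the irrelevance of values off the domain: near each point
  \<open>p\<close> may be compared with a different formula \<open>q\<close>. Smoothness of maps
  defined by cases is proved through this form.\<close>

lemma plot_locally:
  assumes X: "diffeological_space X" and "openin (Euclidean_space n) U"
    and loc: "\<And>u. u \<in> U \<Longrightarrow> \<exists>V q. u \<in> V \<and> V \<subseteq> U \<and> plot X n V q \<and> (\<forall>v\<in>V. p v = q v)"
  shows "plot X n U p"
proof -
  have *: "\<exists>V. openin (Euclidean_space n) V \<and> u \<in> V \<and> V \<subseteq> U \<and> plot X n V p" if u: "u \<in> U" for u
  proof -
    obtain V q where V: "u \<in> V" "V \<subseteq> U" "plot X n V q" "\<forall>v\<in>V. p v = q v"
      using loc[OF u] by blast
    then have "plot X n V p"
      using plot_cong[OF X] by blast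
    with V(1,2) plot_domain(1)[OF X V(3)] show ?thesis
      by blast
  qed
  have "p u \<in> carrier X" if u: "u \<in> U" for u
  proof -
    obtain V where "u \<in> V" "plot X n V p"
      using *[OF u] by blast
    then show ?thesis
      using plot_domain(2)[OF X, of n V p] by blast
  qed
  then have "p \<in> U \<rightarrow> carrier X"
    by blast
  with * assms(2) show ?thesis
    using X[unfolded diffeological_space_def, THEN conjunct2, THEN conjunct2, THEN conjunct2, THEN conjunct2]
    by blast
qed

lemma smooth_map_plot: "smooth_map X Y f \<Longrightarrow> plot X n U p \<Longrightarrow> plot Y n U (\<lambda>u. f (p u))"
  by (simp add: smooth_map_def comp_def)

lemma smooth_map_carrier: "smooth_map X Y f \<Longrightarrow> x \<in> carrier X \<Longrightarrow> f x \<in> carrier Y"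
  by (auto simp: smooth_map_def)

lemma smooth_mapI:
  assumes "\<And>x. x \<in> carrier X \<Longrightarrow> f x \<in> carrier Y"
    and "\<And>n U p. plot X n U p \<Longrightarrow> plot Y n U (\<lambda>u. f (p u))"
  shows "smooth_map X Y f"
  using assms by (simp add: smooth_map_def comp_def)

lemma smooth_map_ident: "smooth_map X X (\<lambda>x. x)"
  by (rule smooth_mapI)

lemma smooth_map_comp: "smooth_map X Y f \<Longrightarrow> smooth_map Y Z g \<Longrightarrow> smooth_map X Z (\<lambda>x. g (f x))"
  by (rule smooth_mapI) (blast dest: smooth_map_carrier smooth_map_plot)+

lemma diffeoI:
  assumes "smooth_map X Y f" "smooth_map Y X g"
    and "\<And>x. x \<in> carrier X \<Longrightarrow> g (f x) = x" "\<And>y. y \<in> carrier Y \<Longrightarrow> f (g y) = y"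
  shows "diffeo X Y f"
  using assms unfolding diffeo_def by blast

lemma diffeoE:
  assumes "diffeo X Y f"
  obtains g where "smooth_map X Y f" "smooth_map Y X g"
    "\<And>x. x \<in> carrier X \<Longrightarrow> g (f x) = x" "\<And>y. y \<in> carrier Y \<Longrightarrow> f (g y) = y"
  using assms unfolding diffeo_def by blast

lemma diffeo_ident: "diffeo X X (\<lambda>x. x)"
  by (rule diffeoI) (rule smooth_map_ident | simp)+

lemma carrier_subset_space [simp]: "carrier (subset_space X A) = carrier X \<inter> A"
  by (simp add: subset_space_def)

lemma plot_subset_space [simp]: "plot (subset_space X A) n U p \<longleftrightarrow> plot X n U p \<and> p \<in> U \<rightarrow> A"
  by (simp add: subset_space_def)

lemma carrier_prod_space [simp]: "carrier (prod_space X Y) = carrier X \<times> carrier Y"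
  by (simp add: prod_space_def)

lemma plot_prod_space [simp]:
  "plot (prod_space X Y) n U p \<longleftrightarrow> plot X n U (\<lambda>u. fst (p u)) \<and> plot Y n U (\<lambda>u. snd (p u))"
  by (simp add: prod_space_def comp_def)

lemma carrier_unit_interval [simp]: "carrier unit_interval = {0..1}"
  by (simp add: unit_interval_def real_space_def)

lemma plot_unit_interval [simp]:
  "plot unit_interval n U p \<longleftrightarrow> smooth_function n U p \<and> p \<in> U \<rightarrow> {0..1}"
  by (simp add: unit_interval_def real_space_def)

lemma diffeological_space_subset:
  assumes "diffeological_space X"
  shows "diffeological_space (subset_space X A)"
  unfolding diffeological_space_def
proof (intro conjI allI impI)
  fix n U p
  assume "plot (subset_space X A) n U p"
  then show "openin (Euclidean_space n) U" "p \<in> U \<rightarrow> carrier (subset_space X A)"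
    using plot_domain[OF assms, of n U p] by auto
next
  fix n U p q
  assume "plot (subset_space X A) n U p \<and> (\<forall>u\<in>U. q u = p u)"
  then show "plot (subset_space X A) n U q"
    using plot_cong[OF assms] by auto
next
  fix n U c
  assume "openin (Euclidean_space n) U \<and> c \<in> carrier (subset_space X A)"
  then show "plot (subset_space X A) n U (\<lambda>_. c)"
    using plot_const[OF assms] by auto
next
  fix m V n U p f
  assume *: "plot (subset_space X A) n U p \<and> smooth_euclidean m V n U f"
  then have "f \<in> V \<rightarrow> U"
    by (simp add: smooth_euclidean_def)
  with * show "plot (subset_space X A) m V (p \<circ> f)"
    using plot_compose[OF assms] by (auto simp: comp_def)
next
  fix n U p
  assume *: "openin (Euclidean_space n) U \<and> p \<in> U \<rightarrow> carrier (subset_space X A) \<and>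
    (\<forall>u\<in>U. \<exists>V. openin (Euclidean_space n) V \<and> u \<in> V \<and> V \<subseteq> U \<and> plot (subset_space X A) n V p)"
  then have "plot X n U p"
    by (intro plot_locally[OF assms]) (simp, metis plot_subset_space)
  with * show "plot (subset_space X A) n U p"
    by auto
qed

text \<open>Meant for \<open>j\<close> injective on the carrier. It changes the type of points of a
  space, so that a structure group can serve as a fibre in \<open>local_trivialisation\<close>,
  where fibres have the point type of the total space.\<close>

definition transport_space :: "('a \<Rightarrow> 'b) \<Rightarrow> 'a diff_space \<Rightarrow> 'b diff_space" where
  "transport_space j X = \<lparr>carrier = j ` carrier X,
     plot = \<lambda>n U p. p \<in> U \<rightarrow> j ` carrier X \<and> plot X n U (\<lambda>u. inv_into (carrier X) j (p u))\<rparr>"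

lemma diffeological_space_transport:
  assumes X: "diffeological_space X"
  shows "diffeological_space (transport_space j X)"
  unfolding diffeological_space_def transport_space_def partial_object.simps diff_space.simps
proof (intro conjI allI impI)
  fix n U p q
  assume *: "(p \<in> U \<rightarrow> j ` carrier X \<and> plot X n U (\<lambda>u. inv_into (carrier X) j (p u))) \<and> (\<forall>u\<in>U. q u = p u)"
  then show "q \<in> U \<rightarrow> j ` carrier X" "plot X n U (\<lambda>u. inv_into (carrier X) j (q u))"
    using plot_cong[OF X, of n U "\<lambda>u. inv_into (carrier X) j (p u)"] by (auto simp: Pi_iff)
next
  fix n U c
  assume "openin (Euclidean_space n) U \<and> c \<in> j ` carrier X"
  then show "(\<lambda>_. c) \<in> U \<rightarrow> j ` carrier X" "plot X n U (\<lambda>_. inv_into (carrier X) j c)"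
    using plot_const[OF X] inv_into_into[of c j "carrier X"] by auto
next
  fix m V n U p f
  assume *: "(p \<in> U \<rightarrow> j ` carrier X \<and> plot X n U (\<lambda>u. inv_into (carrier X) j (p u))) \<and> smooth_euclidean m V n U f"
  then have "f \<in> V \<rightarrow> U"
    by (simp add: smooth_euclidean_def)
  with * show "p \<circ> f \<in> V \<rightarrow> j ` carrier X" "plot X m V (\<lambda>v. inv_into (carrier X) j ((p \<circ> f) v))"
    using plot_compose[OF X, of n U "\<lambda>u. inv_into (carrier X) j (p u)"] by (auto simp: Pi_iff)
next
  fix n U p
  assume *: "openin (Euclidean_space n) U \<and> p \<in> U \<rightarrow> j ` carrier X \<and>
    (\<forall>u\<in>U. \<exists>V. openin (Euclidean_space n) V \<and> u \<in> V \<and> V \<subseteq> U \<and>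
      p \<in> V \<rightarrow> j ` carrier X \<and> plot X n V (\<lambda>u. inv_into (carrier X) j (p u)))"
  then show "plot X n U (\<lambda>u. inv_into (carrier X) j (p u))"
    by (intro plot_locally[OF X]) (simp, metis)
  show "p \<in> U \<rightarrow> j ` carrier X"
    using * by blast
qed (use plot_domain(1)[OF X] in auto)

lemma diffeo_transport:
  assumes "diffeological_space X" "inj_on j (carrier X)"
  shows "diffeo X (transport_space j X) j"
proof (rule diffeoI[where g = "inv_into (carrier X) j"])
  show "smooth_map X (transport_space j X) j"
  proof (rule smooth_mapI)
    fix n U p assume p: "plot X n U p"
    then have "p u \<in> carrier X" if "u \<in> U" for u
      using plot_domain(2)[OF assms(1)] that by blast
    with p show "plot (transport_space j X) n U (\<lambda>u. j (p u))"
      using plot_cong[OF assms(1) p, of "\<lambda>u. inv_into (carrier X) j (j (p u))"] assms(2)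
      by (auto simp: transport_space_def)
  qed (simp add: transport_space_def)
  show "smooth_map (transport_space j X) X (inv_into (carrier X) j)"
    by (rule smooth_mapI) (auto simp: transport_space_def inv_into_into)
qed (use assms in \<open>auto simp: transport_space_def f_inv_into_f\<close>)

subsection \<open>Open subsets of Euclidean spaces\<close>

text \<open>Smoothness constrains only the coordinates below \<open>n\<close>; the others vanish
  identically because values lie in an open subset of \<open>Euclidean_space n\<close>.\<close>

lemma smooth_euclidean_continuous:
  assumes "smooth_euclidean m U n V f"
  shows "continuous_on U f"
proof (rule continuous_on_coordinatewise_then_product)
  fix j
  have "f x \<in> topspace (Euclidean_space n)" if "x \<in> U" for x
    using assms that openin_subset unfolding smooth_euclidean_def by blast
  then have "f x j = 0" if "x \<in> U" "j \<ge> n" for x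
    using that by (simp add: topspace_Euclidean_space)
  moreover have "continuous_on U (\<lambda>x. f x j)" if "j < n"
    using assms that Ck_continuous[of 0 m U "\<lambda>x. f x j"]
    unfolding smooth_euclidean_def smooth_function_iff_Ck by blast
  ultimately show "continuous_on U (\<lambda>x. f x j)"
    using continuous_on_cong[of U U "\<lambda>x. f x j" "\<lambda>_. 0"] by (cases "j < n") auto
qed

lemma D_open_euclidean_open:
  assumes "openin (Euclidean_space n) V" "V \<subseteq> U"
  shows "D_open (euclidean_open n U) V"
proof -
  obtain T where T: "open T" "V = T \<inter> {x. \<forall>i\<ge>n. x i = 0}"
    using assms(1) unfolding Euclidean_space_openin_iff by blast
  have "openin (Euclidean_space m) {w \<in> W. f w \<in> V}" if f: "smooth_euclidean m W n U f" for m W f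
  proof -
    have W: "openin (Euclidean_space m) W" and "f w \<in> topspace (Euclidean_space n)" if "w \<in> W" for w
      using f that openin_subset unfolding smooth_euclidean_def by blast+
    then have "{w \<in> W. f w \<in> V} = W \<inter> f -` T"
      by (auto simp: T topspace_Euclidean_space)
    moreover have "openin (top_of_set W) (W \<inter> f -` T)"
      using continuous_openin_preimage_gen[OF smooth_euclidean_continuous[OF f] T(1)] .
    moreover have W: "openin (Euclidean_space m) W"
      using f by (simp add: smooth_euclidean_def)
    ultimately show ?thesis
      by (simp add: openin_open_subtopology[OF W] flip: Euclidean_subtopology[OF W])
  qed
  then show ?thesis
    using assms(2) by (simp add: D_open_def euclidean_open_def)
qed

text \<open>The topspace is found directly: \<open>U\<close> is itself D-open, and D-open sets lie
  in the carrier.\<close>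

lemma open_cover_euclidean_open:
  assumes "openin (Euclidean_space n) U" "\<And>V. V \<in> \<V> \<Longrightarrow> openin (Euclidean_space n) V" "\<Union>\<V> = U"
  shows "open_cover (D_topology (euclidean_open n U)) \<V>"
proof -
  have "openin (D_topology (euclidean_open n U)) U"
    using D_open_euclidean_open[OF assms(1)] by (simp add: openin_D_topology)
  moreover have "topspace (D_topology (euclidean_open n U)) \<subseteq> U"
    using openin_topspace[of "D_topology (euclidean_open n U)"]
    by (simp add: openin_D_topology D_open_def euclidean_open_def)
  ultimately have "topspace (D_topology (euclidean_open n U)) = U"
    using openin_subset by blast
  then show ?thesis
    using assms(2,3) D_open_euclidean_open[of n _ U] unfolding open_cover_def openin_D_topology by blast
qed

lemma smooth_euclidean_subset_iff:
  assumes "openin (Euclidean_space n) U" "openin (Euclidean_space n) V" "V \<subseteq> U"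
  shows "smooth_euclidean m W n U f \<and> f \<in> W \<rightarrow> V \<longleftrightarrow> smooth_euclidean m W n V f"
  using assms unfolding smooth_euclidean_def by auto

lemma subset_space_euclidean_open:
  assumes "openin (Euclidean_space n) U" "openin (Euclidean_space n) V" "V \<subseteq> U"
  shows "subset_space (euclidean_open n U) V = euclidean_open n V"
  using assms smooth_euclidean_subset_iff[OF assms]
  by (simp add: subset_space_def euclidean_open_def Int_absorb1)

lemma carrier_euclidean_open [simp]: "carrier (euclidean_open n U) = U"
  and plot_euclidean_open [simp]: "plot (euclidean_open n U) m V f \<longleftrightarrow> smooth_euclidean m V n U f"
  by (simp_all add: euclidean_open_def)

section \<open>Pullbacks and a criterion for fibre bundles\<close>

lemma carrier_pullback [simp]:
  "carrier (pullback Y f E \<pi>) = {(y, e). y \<in> carrier Y \<and> e \<in> carrier E \<and> f y = \<pi> e}"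
  by (auto simp: pullback_def)

lemma plot_pullback [simp]:
  "plot (pullback Y f E \<pi>) n U p \<longleftrightarrow> plot Y n U (\<lambda>u. fst (p u)) \<and> plot E n U (\<lambda>u. snd (p u)) \<and>
    (\<forall>u\<in>U. f (fst (p u)) = \<pi> (snd (p u)))"
  by (auto simp: pullback_def Pi_iff split_beta)

lemma subset_space_pullback:
  assumes "openin (Euclidean_space n) U" "openin (Euclidean_space n) V" "V \<subseteq> U"
  shows "subset_space (pullback (euclidean_open n U) p E \<pi>) {e. fst e \<in> V} =
    pullback (euclidean_open n V) p E \<pi>"
proof -
  have "plot (subset_space (pullback (euclidean_open n U) p E \<pi>) {e. fst e \<in> V}) m W q \<longleftrightarrow>
      plot (pullback (euclidean_open n V) p E \<pi>) m W q" for m W q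
    using smooth_euclidean_subset_iff[OF assms, of m W "\<lambda>u. fst (q u)"] by auto
  moreover have "carrier (subset_space (pullback (euclidean_open n U) p E \<pi>) {e. fst e \<in> V}) =
      carrier (pullback (euclidean_open n V) p E \<pi>)"
    using assms(3) by auto
  ultimately show ?thesis
    by (intro diff_space.equality) (auto simp: fun_eq_iff)
qed

text \<open>Charts of principal bundles run from the product to the pullback and have a group as
  fibre. The criterion inverts them and replaces the group by a copy of it inside the pullback, as
  the typing of fibres demands.\<close>

lemma fibre_bundleI:
  fixes E :: "'e diff_space" and D :: "'g diff_space"
  assumes E: "diffeological_space E" and X: "diffeological_space X" and D: "diffeological_space D"
    and "smooth_map E X \<pi>" "\<pi> ` carrier E = carrier X"
    and triv: "\<And>n U p u. plot X n U p \<Longrightarrow> u \<in> U \<Longrightarrow>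
      \<exists>V \<theta>. openin (Euclidean_space n) V \<and> u \<in> V \<and> V \<subseteq> U \<and>
        diffeo (prod_space (euclidean_open n V) D) (pullback (euclidean_open n V) p E \<pi>) \<theta> \<and>
        (\<forall>v\<in>V. \<forall>g\<in>carrier D. fst (\<theta> (v, g)) = v)"
  shows "fibre_bundle E X \<pi>"
proof -
  have "\<exists>\<U>. local_trivialisation (pullback (euclidean_open n U) p E \<pi>) (euclidean_open n U) fst \<U>"
    if p: "plot X n U p" for n U p
  proof -
    have U: "openin (Euclidean_space n) U"
      using plot_domain(1)[OF X p] .
    \<comment> \<open>Taking all trivialising open sets at once avoids choosing one for each
      point.\<close>
    define \<V> where "\<V> = {V. openin (Euclidean_space n) V \<and> V \<subseteq> U \<and>
      (\<exists>F :: ((nat \<Rightarrow> real) \<times> 'e) diff_space. diffeological_space F \<and>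
        trivial_bundle (pullback (euclidean_open n V) p E \<pi>) (euclidean_open n V) fst F)}"
    have "\<exists>V\<in>\<V>. u \<in> V" if u: "u \<in> U" for u
    proof -
      obtain V \<theta> where V: "openin (Euclidean_space n) V" "u \<in> V" "V \<subseteq> U"
        and \<theta>: "diffeo (prod_space (euclidean_open n V) D) (pullback (euclidean_open n V) p E \<pi>) \<theta>"
        and fst: "\<And>v g. v \<in> V \<Longrightarrow> g \<in> carrier D \<Longrightarrow> fst (\<theta> (v, g)) = v"
        using triv[OF p u] by blast
      obtain \<theta>' where \<theta>'_smooth:
          "smooth_map (pullback (euclidean_open n V) p E \<pi>) (prod_space (euclidean_open n V) D) \<theta>'"
        and \<theta>': "\<And>x. x \<in> carrier (prod_space (euclidean_open n V) D) \<Longrightarrow> \<theta>' (\<theta> x) = x"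
          "\<And>e. e \<in> carrier (pullback (euclidean_open n V) p E \<pi>) \<Longrightarrow> \<theta> (\<theta>' e) = e"
        and \<theta>_smooth: "smooth_map (prod_space (euclidean_open n V) D) (pullback (euclidean_open n V) p E \<pi>) \<theta>"
        using \<theta> unfolding diffeo_def by blast
      \<comment> \<open>The chart embeds \<open>D\<close> as the fibre over \<open>u\<close>;
        injectivity comes from the second component of the inverse chart.\<close>
      let ?j = "\<lambda>g. \<theta> (u, g)"
      let ?F = "transport_space ?j D"
      have j: "inj_on ?j (carrier D)"
        using \<theta>'(1) V(2) by (intro inj_on_inverseI[where g = "\<lambda>e. snd (\<theta>' e)"]) simp
      obtain j' where j_smooth: "smooth_map D ?F ?j" and j'_smooth: "smooth_map ?F D j'"
        and j': "\<And>g. g \<in> carrier D \<Longrightarrow> j' (?j g) = g" "\<And>f. f \<in> carrier ?F \<Longrightarrow> ?j (j' f) = f"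
        using diffeo_transport[OF D j] unfolding diffeo_def by blast
      have in_prod: "\<theta>' e \<in> V \<times> carrier D" if "e \<in> carrier (pullback (euclidean_open n V) p E \<pi>)" for e
        using smooth_map_carrier[OF \<theta>'_smooth that] by simp
      have m: "smooth_map (prod_space (euclidean_open n V) D) (prod_space (euclidean_open n V) ?F) (map_prod id ?j)"
        by (rule smooth_mapI) (auto intro: smooth_map_carrier[OF j_smooth] smooth_map_plot[OF j_smooth])
      have m': "smooth_map (prod_space (euclidean_open n V) ?F) (prod_space (euclidean_open n V) D) (map_prod id j')"
        by (rule smooth_mapI) (auto intro: smooth_map_carrier[OF j'_smooth] smooth_map_plot[OF j'_smooth])
      have "diffeo (pullback (euclidean_open n V) p E \<pi>) (prod_space (euclidean_open n V) ?F)
          (\<lambda>e. map_prod id ?j (\<theta>' e))"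
      proof (rule diffeoI[OF smooth_map_comp[OF \<theta>'_smooth m] smooth_map_comp[OF m' \<theta>_smooth]])
        fix e assume e: "e \<in> carrier (pullback (euclidean_open n V) p E \<pi>)"
        then have "map_prod id j' (map_prod id ?j (\<theta>' e)) = \<theta>' e"
          using in_prod[OF e] j'(1) by (cases "\<theta>' e") auto
        then show "\<theta> (map_prod id j' (map_prod id ?j (\<theta>' e))) = e"
          using \<theta>'(2)[OF e] by simp
      next
        fix y assume y: "y \<in> carrier (prod_space (euclidean_open n V) ?F)"
        have "map_prod id ?j (\<theta>' (\<theta> (map_prod id j' y))) = map_prod id ?j (map_prod id j' y)"
          using \<theta>'(1)[OF smooth_map_carrier[OF m' y]] by simp
        also have "\<dots> = y"
          using y j'(2) by (cases y) auto
        finally show "map_prod id ?j (\<theta>' (\<theta> (map_prod id j' y))) = y" .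
      qed
      moreover have "fst (map_prod id ?j (\<theta>' e)) = fst e"
        if e: "e \<in> carrier (pullback (euclidean_open n V) p E \<pi>)" for e
        using fst[of "fst (\<theta>' e)" "snd (\<theta>' e)"] in_prod[OF e] \<theta>'(2)[OF e] by (auto simp: mem_Times_iff)
      ultimately have "trivial_bundle (pullback (euclidean_open n V) p E \<pi>) (euclidean_open n V) fst ?F"
        unfolding trivial_bundle_def by blast
      then show ?thesis
        using V diffeological_space_transport[OF D] unfolding \<V>_def by blast
    qed
    then have "\<Union>\<V> = U"
      unfolding \<V>_def by blast
    then have "open_cover (D_topology (euclidean_open n U)) \<V>"
      by (intro open_cover_euclidean_open[OF U]) (auto simp: \<V>_def)
    moreover have "\<exists>F :: ((nat \<Rightarrow> real) \<times> 'e) diff_space. diffeological_space F \<and>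
        trivial_bundle (subset_space (pullback (euclidean_open n U) p E \<pi>) {e. fst e \<in> V})
          (subset_space (euclidean_open n U) V) fst F" if "V \<in> \<V>" for V
      using that subset_space_pullback[OF U, of V p E \<pi>] subset_space_euclidean_open[OF U, of V]
      unfolding \<V>_def by force
    ultimately show ?thesis
      unfolding local_trivialisation_def by blast
  qed
  then show ?thesis
    using assms unfolding fibre_bundle_def by blast
qed

text \<open>Bijectivity of each restricted map follows from the pointwise laws, with the action of
  the inverse element as inverse map.\<close>

lemma group_actionI:
  assumes "group G"
    and cl: "\<And>g x. g \<in> carrier G \<Longrightarrow> x \<in> S \<Longrightarrow> a g x \<in> S"
    and one: "\<And>x. x \<in> S \<Longrightarrow> a \<one>\<^bsub>G\<^esub> x = x"
    and mult: "\<And>g h x. g \<in> carrier G \<Longrightarrow> h \<in> carrier G \<Longrightarrow> x \<in> S \<Longrightarrow> a (g \<otimes>\<^bsub>G\<^esub> h) x = a g (a h x)"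
  shows "group_action G S (\<lambda>g. restrict (a g) S)"
proof -
  interpret group G by fact
  have inv: "a (inv\<^bsub>G\<^esub> g) (a g x) = x" "a g (a (inv\<^bsub>G\<^esub> g) x) = x" if "g \<in> carrier G" "x \<in> S" for g x
    using that mult[of "inv\<^bsub>G\<^esub> g" g x] mult[of g "inv\<^bsub>G\<^esub> g" x] one by simp_all
  have Bij: "restrict (a g) S \<in> Bij S" if g: "g \<in> carrier G" for g
  proof -
    have "bij_betw (a g) S S"
      using g cl inv by (intro bij_betw_byWitness[where f' = "a (inv\<^bsub>G\<^esub> g)"]) auto
    then show ?thesis
      by (simp add: Bij_def cong: bij_betw_cong)
  qed
  have "restrict (a (g \<otimes>\<^bsub>G\<^esub> h)) S = compose S (restrict (a g) S) (restrict (a h) S)"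
    if "g \<in> carrier G" "h \<in> carrier G" for g h
    using that cl mult by (auto simp: compose_def fun_eq_iff)
  then have "(\<lambda>g. restrict (a g) S) \<in> hom G (BijGroup S)"
    using Bij by (auto simp: hom_def BijGroup_def)
  then show ?thesis
    unfolding group_action_def group_hom_def group_hom_axioms_def
    using group_BijGroup is_group by blast
qed

section \<open>Diffeological groups and principal bundles\<close>

locale diff_group = group G for G :: "('g, 'm) monoid_scheme" (structure) +
  fixes D :: "'g diff_space"
  assumes diffeological_group: "diffeological_group G D"
begin

lemma D_diffeological: "diffeological_space D"
  and carrier_D [simp]: "carrier D = carrier G"
  and smooth_mult: "smooth_map (prod_space D D) D (\<lambda>(g, h). g \<otimes> h)"
  and smooth_inv: "smooth_map D D (\<lambda>g. inv g)"
  using diffeological_group by (simp_all add: diffeological_group_def)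

lemma plot_mult: "plot D n U a \<Longrightarrow> plot D n U b \<Longrightarrow> plot D n U (\<lambda>u. a u \<otimes> b u)"
  using smooth_map_plot[OF smooth_mult, of n U "\<lambda>u. (a u, b u)"] by simp

lemma plot_inv: "plot D n U a \<Longrightarrow> plot D n U (\<lambda>u. inv (a u))"
  using smooth_map_plot[OF smooth_inv, of n U a] by simp

lemma mult_inv_cancel [simp]:
  assumes "a \<in> carrier G" "b \<in> carrier G"
  shows "inv a \<otimes> (a \<otimes> b) = b" "a \<otimes> (inv a \<otimes> b) = b"
  using assms by (simp_all flip: m_assoc)

end

section \<open>Principal bundles: fibres as free orbits, and the division map\<close>

locale principal = diff_group G D for G :: "('g, 'm) monoid_scheme" (structure) and D +
  fixes E :: "'e diff_space" and X :: "'x diff_space" and \<pi> :: "'e \<Rightarrow> 'x" and act :: "'g \<Rightarrow> 'e \<Rightarrow> 'e"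
  assumes principal: "principal_bundle G D E X \<pi> act"
begin

lemma E_diffeological: "diffeological_space E" and X_diffeological: "diffeological_space X"
  and \<pi>_smooth: "smooth_map E X \<pi>" and \<pi>_surj: "\<pi> ` carrier E = carrier X"
  using principal unfolding principal_bundle_def fibre_bundle_def by simp_all

lemma \<pi>_carrier: "e \<in> carrier E \<Longrightarrow> \<pi> e \<in> carrier X"
  using \<pi>_surj by blast

lemma action: "group_action G (carrier E) (\<lambda>g. restrict (act g) (carrier E))"
  and act_smooth: "smooth_map (prod_space D E) E (\<lambda>(g, e). act g e)"
  using principal unfolding principal_bundle_def smooth_action_def by simp_all

lemma act_closed [simp]: "g \<in> carrier G \<Longrightarrow> e \<in> carrier E \<Longrightarrow> act g e \<in> carrier E"
  using smooth_map_carrier[OF act_smooth, of "(g, e)"] by simp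

lemma act_one [simp]: "e \<in> carrier E \<Longrightarrow> act \<one> e = e"
  using group_action.id_eq_one[OF action] by (metis restrict_apply')

lemma act_mult:
  "g \<in> carrier G \<Longrightarrow> h \<in> carrier G \<Longrightarrow> e \<in> carrier E \<Longrightarrow> act (g \<otimes> h) e = act g (act h e)"
  using group_action.composition_rule[OF action, of e g h] by simp

lemma act_inv [simp]:
  assumes "g \<in> carrier G" "e \<in> carrier E"
  shows "act (inv g) (act g e) = e" "act g (act (inv g) e) = e"
  using assms act_mult[of "inv g" g e] act_mult[of g "inv g" e] by simp_all

lemma plot_act: "plot D n U a \<Longrightarrow> plot E n U p \<Longrightarrow> plot E n U (\<lambda>u. act (a u) (p u))"
  using smooth_map_plot[OF act_smooth, of n U "\<lambda>u. (a u, p u)"] by simp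

lemma plot_E_carrier: "plot E n U p \<Longrightarrow> u \<in> U \<Longrightarrow> p u \<in> carrier E"
  using plot_domain(2)[OF E_diffeological, of n U p] by auto

lemma local_product:
  assumes "plot X n U p" "u \<in> U"
  obtains V q where "openin (Euclidean_space n) V" "u \<in> V" "V \<subseteq> U" "plot E n V q"
    "\<And>v. v \<in> V \<Longrightarrow> \<pi> (q v) = p v"
    "diffeo (prod_space (euclidean_open n V) D) (pullback (euclidean_open n V) p E \<pi>)
       (\<lambda>(v, g). (v, act g (q v)))"
  using principal[unfolded principal_bundle_def, THEN conjunct2, THEN conjunct2, THEN conjunct2,
      rule_format, OF conjI[OF assms]] that
  by (elim exE conjE) (rule that; simp)

text \<open>The chart condition is applied to a constant plot on the zero-dimensional space, whose
  only point is the zero sequence. The chart then identifies the fibre over \<open>x\<close> with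
  \<open>G\<close> through the orbit of one point \<open>e0\<close>.\<close>

lemma reference_point:
  assumes "x \<in> carrier X"
  obtains e0 where "e0 \<in> carrier E" "\<And>g. g \<in> carrier G \<Longrightarrow> \<pi> (act g e0) = x"
    "\<And>e. e \<in> carrier E \<Longrightarrow> \<pi> e = x \<Longrightarrow> \<exists>g\<in>carrier G. act g e0 = e"
    "inj_on (\<lambda>g. act g e0) (carrier G)"
proof -
  have "plot X 0 (topspace (Euclidean_space 0)) (\<lambda>_. x)"
    by (rule plot_const[OF X_diffeological openin_topspace assms])
  moreover have "(\<lambda>_. 0) \<in> topspace (Euclidean_space 0)"
    by (simp add: topspace_Euclidean_space)
  ultimately obtain V q where V: "(\<lambda>_. 0) \<in> V" and q: "plot E 0 V q"
    and d: "diffeo (prod_space (euclidean_open 0 V) D) (pullback (euclidean_open 0 V) (\<lambda>_. x) E \<pi>)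
       (\<lambda>(v, g). (v, act g (q v)))"
    by (rule local_product)
  obtain \<theta>' where
      \<theta>: "smooth_map (prod_space (euclidean_open 0 V) D) (pullback (euclidean_open 0 V) (\<lambda>_. x) E \<pi>)
       (\<lambda>(v, g). (v, act g (q v)))"
    and \<theta>': "smooth_map (pullback (euclidean_open 0 V) (\<lambda>_. x) E \<pi>) (prod_space (euclidean_open 0 V) D) \<theta>'"
    and inv1: "\<And>y. y \<in> V \<times> carrier G \<Longrightarrow> \<theta>' (case y of (v, g) \<Rightarrow> (v, act g (q v))) = y"
    and inv2: "\<And>y. y \<in> carrier (pullback (euclidean_open 0 V) (\<lambda>_. x) E \<pi>) \<Longrightarrow>
      (case \<theta>' y of (v, g) \<Rightarrow> (v, act g (q v))) = y"
    using d unfolding diffeo_def by auto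
  let ?o = "\<lambda>_ :: nat. 0 :: real"
  show thesis
  proof (rule that)
    show "q ?o \<in> carrier E"
      using plot_E_carrier[OF q V] .
    show "\<pi> (act g (q ?o)) = x" if "g \<in> carrier G" for g
      using smooth_map_carrier[OF \<theta>, of "(?o, g)"] V that by simp
    show "\<exists>g\<in>carrier G. act g (q ?o) = e" if e: "e \<in> carrier E" "\<pi> e = x" for e
    proof -
      have y: "(?o, e) \<in> carrier (pullback (euclidean_open 0 V) (\<lambda>_. x) E \<pi>)"
        using e V by simp
      then show ?thesis
        using smooth_map_carrier[OF \<theta>' y] inv2[OF y] by (auto split: prod.splits)
    qed
    show "inj_on (\<lambda>g. act g (q ?o)) (carrier G)"
      using inv1[of "(?o, _)"] V by (intro inj_on_inverseI[where g = "\<lambda>e. snd (\<theta>' (?o, e))"]) simp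
  qed
qed

text \<open>That the action preserves fibres is extracted from the charts: with \<open>e\<close>
  written as \<open>act h e0\<close>, the point \<open>act g e\<close> stays in the orbit of
  \<open>e0\<close>, which is the fibre.\<close>

lemma \<pi>_act [simp]:
  assumes "g \<in> carrier G" "e \<in> carrier E"
  shows "\<pi> (act g e) = \<pi> e"
proof -
  obtain e0 where e0: "e0 \<in> carrier E" "\<And>g. g \<in> carrier G \<Longrightarrow> \<pi> (act g e0) = \<pi> e"
    "\<And>e'. e' \<in> carrier E \<Longrightarrow> \<pi> e' = \<pi> e \<Longrightarrow> \<exists>g\<in>carrier G. act g e0 = e'"
    using reference_point[OF \<pi>_carrier[OF assms(2)]] by metis
  then obtain h where h: "h \<in> carrier G" "act h e0 = e"
    using assms(2) by blast
  then have "act g e = act (g \<otimes> h) e0"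
    using act_mult assms e0(1) by simp
  then show ?thesis
    using e0(2)[of "g \<otimes> h"] assms h by simp
qed

lemma act_free:
  assumes "g \<in> carrier G" "h \<in> carrier G" "e \<in> carrier E" "act g e = act h e"
  shows "g = h"
proof -
  obtain e0 where e0: "e0 \<in> carrier E"
    "\<And>e'. e' \<in> carrier E \<Longrightarrow> \<pi> e' = \<pi> e \<Longrightarrow> \<exists>g\<in>carrier G. act g e0 = e'"
    "inj_on (\<lambda>g. act g e0) (carrier G)"
    using reference_point[OF \<pi>_carrier[OF assms(3)]] by metis
  then obtain k where k: "k \<in> carrier G" "act k e0 = e"
    using assms(3) by blast
  then have "act (g \<otimes> k) e0 = act (h \<otimes> k) e0"
    using act_mult assms e0(1) by simp
  then have "g \<otimes> k = h \<otimes> k"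
    using inj_onD[OF e0(3)] assms k by simp
  then show ?thesis
    using assms k by simp
qed

lemma act_transitive:
  assumes "e \<in> carrier E" "e' \<in> carrier E" "\<pi> e = \<pi> e'"
  obtains g where "g \<in> carrier G" "act g e' = e"
proof -
  obtain e0 where e0: "e0 \<in> carrier E"
    "\<And>e'. e' \<in> carrier E \<Longrightarrow> \<pi> e' = \<pi> e \<Longrightarrow> \<exists>g\<in>carrier G. act g e0 = e'"
    using reference_point[OF \<pi>_carrier[OF assms(1)]] by metis
  obtain g h where "g \<in> carrier G" "act g e0 = e" "h \<in> carrier G" "act h e0 = e'"
    using e0(2)[of e] e0(2)[of e'] assms by metis
  then show thesis
    using e0(1) act_mult by (intro that[of "g \<otimes> inv h"]) auto
qed

text \<open>The division map of the principal bundle, meaningful for two points of one fibre, where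
  the action is free and transitive.\<close>

definition quot :: "'e \<Rightarrow> 'e \<Rightarrow> 'g" where
  "quot e e' = (THE g. g \<in> carrier G \<and> act g e' = e)"

lemma quot_eqI:
  "g \<in> carrier G \<Longrightarrow> e' \<in> carrier E \<Longrightarrow> act g e' = e \<Longrightarrow> quot e e' = g"
  unfolding quot_def using act_free by blast

lemma quot:
  assumes "e \<in> carrier E" "e' \<in> carrier E" "\<pi> e = \<pi> e'"
  shows "quot e e' \<in> carrier G" "act (quot e e') e' = e"
  using act_transitive[OF assms] quot_eqI[OF _ assms(2)] by metis+

text \<open>Smoothness of the division map. Near a point a local section \<open>q\<close> serves as
  common reference, and the quotient of \<open>p\<close> by \<open>p'\<close> is assembled from
  their quotients by \<open>q\<close>.\<close>

lemma plot_quot: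
  assumes p: "plot E n U p" and p': "plot E n U p'" and eq: "\<And>u. u \<in> U \<Longrightarrow> \<pi> (p u) = \<pi> (p' u)"
  shows "plot D n U (\<lambda>u. quot (p u) (p' u))"
proof (rule plot_locally[OF D_diffeological plot_domain(1)[OF E_diffeological p]])
  fix u assume u: "u \<in> U"
  obtain V q where V: "openin (Euclidean_space n) V" "u \<in> V" "V \<subseteq> U" and q: "plot E n V q"
    and \<pi>q: "\<And>v. v \<in> V \<Longrightarrow> \<pi> (q v) = \<pi> (p v)"
    and d: "diffeo (prod_space (euclidean_open n V) D) (pullback (euclidean_open n V) (\<lambda>u. \<pi> (p u)) E \<pi>)
       (\<lambda>(v, g). (v, act g (q v)))"
    by (rule local_product[OF smooth_map_plot[OF \<pi>_smooth p] u]) (rule that)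
  obtain \<theta>' where
      \<theta>': "smooth_map (pullback (euclidean_open n V) (\<lambda>u. \<pi> (p u)) E \<pi>) (prod_space (euclidean_open n V) D) \<theta>'"
    and inv: "\<And>y. y \<in> carrier (pullback (euclidean_open n V) (\<lambda>u. \<pi> (p u)) E \<pi>) \<Longrightarrow>
      (case \<theta>' y of (v, g) \<Rightarrow> (v, act g (q v))) = y"
    using d unfolding diffeo_def by auto
  \<comment> \<open>Against \<open>q\<close> the quotient is the group component of the inverse
    chart, hence smooth.\<close>
  have quot_q: "plot D n V (\<lambda>v. quot (f v) (q v))"
    if f: "plot E n V f" and \<pi>f: "\<And>v. v \<in> V \<Longrightarrow> \<pi> (f v) = \<pi> (p v)" for f
  proof -
    have "plot (pullback (euclidean_open n V) (\<lambda>u. \<pi> (p u)) E \<pi>) n V (\<lambda>v. (v, f v))"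
      using f \<pi>f smooth_euclidean_inclusion[OF V(1) V(1)] by simp
    from smooth_map_plot[OF \<theta>' this] have "plot D n V (\<lambda>v. snd (\<theta>' (v, f v)))"
      by simp
    moreover have "quot (f v) (q v) = snd (\<theta>' (v, f v))" if v: "v \<in> V" for v
    proof -
      have y: "(v, f v) \<in> carrier (pullback (euclidean_open n V) (\<lambda>u. \<pi> (p u)) E \<pi>)"
        using plot_E_carrier[OF f v] \<pi>f v by simp
      show ?thesis
        using smooth_map_carrier[OF \<theta>' y] inv[OF y] plot_E_carrier[OF q v]
        by (intro quot_eqI) (auto split: prod.splits)
    qed
    ultimately show ?thesis
      by (rule plot_cong[OF D_diffeological])
  qed
  have pV: "plot E n V p" "plot E n V p'"
    using plot_restrict[OF E_diffeological _ V(1,3)] p p' by blast+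
  have "plot D n V (\<lambda>v. quot (p v) (q v) \<otimes> inv (quot (p' v) (q v)))"
    using pV eq V(3) by (intro plot_mult plot_inv quot_q) auto
  moreover have "quot (p v) (p' v) = quot (p v) (q v) \<otimes> inv (quot (p' v) (q v))" if v: "v \<in> V" for v
  proof -
    note c = plot_E_carrier[OF pV(1) v] plot_E_carrier[OF pV(2) v] plot_E_carrier[OF q v]
    have "\<pi> (p' v) = \<pi> (q v)" "\<pi> (p v) = \<pi> (q v)"
      using eq[of v] \<pi>q[OF v] V(3) v by auto
    note a = quot[OF c(1,3) this(2)] quot[OF c(2,3) this(1)]
    have "act (inv (quot (p' v) (q v))) (p' v) = q v"
      using act_inv(1)[OF a(3) c(3)] a(4) by simp
    then show ?thesis
      using a c act_mult by (intro quot_eqI) auto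
  qed
  ultimately show "\<exists>V q. u \<in> V \<and> V \<subseteq> U \<and> plot D n V q \<and> (\<forall>v\<in>V. quot (p v) (p' v) = q v)"
    using V by blast
qed

end

section \<open>Contractions of the kernel of the retraction\<close>

locale retracted_group = diff_group G D for G :: "('g, 'm) monoid_scheme" (structure) and D +
  fixes H :: "'g set" and \<Phi> :: "'g \<times> real \<Rightarrow> 'g"
  assumes subgroup_H: "subgroup H G"
    and retraction: "smooth_strong_deformation_retraction D H \<Phi>"
    and hom: "\<forall>\<tau>\<in>{0..1}. (\<lambda>g. \<Phi> (g, \<tau>)) \<in> hom G G"
begin

abbreviation retr :: "'g \<Rightarrow> 'g" where "retr g \<equiv> \<Phi> (g, 0)"

lemma H_carrier: "h \<in> H \<Longrightarrow> h \<in> carrier G"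
  using subgroup.mem_carrier[OF subgroup_H] .

lemma group_hom_\<Phi>: "\<tau> \<in> {0..1} \<Longrightarrow> group_hom G G (\<lambda>g. \<Phi> (g, \<tau>))"
  using hom is_group by (simp add: group_hom_def group_hom_axioms_def)

lemma
  assumes "\<tau> \<in> {0..1}" "g \<in> carrier G"
  shows \<Phi>_closed [simp]: "\<Phi> (g, \<tau>) \<in> carrier G"
    and \<Phi>_inv: "\<Phi> (inv g, \<tau>) = inv (\<Phi> (g, \<tau>))"
    and \<Phi>_mult: "h \<in> carrier G \<Longrightarrow> \<Phi> (g \<otimes> h, \<tau>) = \<Phi> (g, \<tau>) \<otimes> \<Phi> (h, \<tau>)"
  using group_hom.hom_closed[OF group_hom_\<Phi>] group_hom.hom_inv[OF group_hom_\<Phi>]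
    group_hom.hom_mult[OF group_hom_\<Phi>] assms by auto

lemma \<Phi>_H: "h \<in> H \<Longrightarrow> \<tau> \<in> {0..1} \<Longrightarrow> \<Phi> (h, \<tau>) = h"
  and \<Phi>_1: "g \<in> carrier G \<Longrightarrow> \<Phi> (g, 1) = g"
  and retr_H: "g \<in> carrier G \<Longrightarrow> retr g \<in> H"
  using retraction by (auto simp: smooth_strong_deformation_retraction_def)

lemma retr_retr [simp]: "g \<in> carrier G \<Longrightarrow> retr (retr g) = retr g"
  by (simp add: \<Phi>_H retr_H)

lemma plot_\<Phi>:
  "plot D n U a \<Longrightarrow> smooth_function n U t \<Longrightarrow> t \<in> U \<rightarrow> {0..1} \<Longrightarrow> plot D n U (\<lambda>u. \<Phi> (a u, t u))"
  using retraction smooth_map_plot[of "prod_space D unit_interval" D \<Phi> n U "\<lambda>u. (a u, t u)"]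
  by (simp add: smooth_strong_deformation_retraction_def)

lemma plot_retr: "plot D n U a \<Longrightarrow> plot D n U (\<lambda>u. retr (a u))"
  using plot_\<Phi>[of n U a "\<lambda>_. 0"] smooth_function_const plot_domain(1)[OF D_diffeological] by simp

text \<open>The right factor moves \<open>\<Phi> (k, \<tau>)\<close> into the kernel of
  \<open>retr\<close>; the homomorphisms \<open>\<Phi> (-, \<tau>)\<close> are not assumed to
  preserve that kernel.\<close>

definition contr :: "real \<Rightarrow> 'g \<Rightarrow> 'g" where
  "contr \<tau> k = \<Phi> (k, \<tau>) \<otimes> inv (retr (\<Phi> (k, \<tau>)))"

text \<open>Both \<open>\<Phi> (-, \<tau>)\<close> and \<open>retr\<close> are homomorphisms fixing
  \<open>h\<close>, so each commutes with conjugation by \<open>h\<close>, and the inner factors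
  \<open>inv h\<close> and \<open>h\<close> cancel.\<close>

lemma contr_conj:
  assumes "\<tau> \<in> {0..1}" "h \<in> H" "k \<in> carrier G"
  shows "contr \<tau> (h \<otimes> k \<otimes> inv h) = h \<otimes> contr \<tau> k \<otimes> inv h"
proof -
  have "inv h \<in> H" "retr h = h"
    using assms(2) subgroup.m_inv_closed[OF subgroup_H] by (auto simp: \<Phi>_H)
  then show ?thesis
    using assms by (simp add: contr_def H_carrier \<Phi>_mult \<Phi>_inv \<Phi>_H m_assoc inv_mult_group)
qed

definition mix :: "real \<Rightarrow> 'g \<Rightarrow> 'g \<Rightarrow> 'g" where
  "mix \<tau> a b = a \<otimes> contr \<tau> (inv a \<otimes> b)"

lemma contr_closed [simp]: "\<tau> \<in> {0..1} \<Longrightarrow> k \<in> carrier G \<Longrightarrow> contr \<tau> k \<in> carrier G"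
  by (simp add: contr_def)

lemma mix_closed: "\<tau> \<in> {0..1} \<Longrightarrow> a \<in> carrier G \<Longrightarrow> b \<in> carrier G \<Longrightarrow> mix \<tau> a b \<in> carrier G"
  by (simp add: mix_def)

text \<open>Since \<open>retr\<close> is idempotent, every value of \<open>contr\<close> lies in its
  kernel; multiplying by \<open>a\<close> from the kernel stays there.\<close>

lemma retr_mix:
  assumes "\<tau> \<in> {0..1}" "a \<in> carrier G" "b \<in> carrier G" "retr a = \<one>"
  shows "retr (mix \<tau> a b) = \<one>"
  using assms by (simp add: mix_def contr_def \<Phi>_mult \<Phi>_inv)

lemma mix_0: "a \<in> carrier G \<Longrightarrow> b \<in> carrier G \<Longrightarrow> mix 0 a b = a"
  by (simp add: mix_def contr_def)

text \<open>For \<open>a\<close> and \<open>b\<close> in the kernel, \<open>retr\<close> kills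
  \<open>inv a \<otimes> b\<close>, so the correction factor of \<open>contr\<close> disappears at
  the end of the path.\<close>

lemma mix_1:
  assumes "a \<in> carrier G" "b \<in> carrier G" "retr a = \<one>" "retr b = \<one>"
  shows "mix 1 a b = b"
  using assms by (simp add: mix_def contr_def \<Phi>_1 \<Phi>_mult \<Phi>_inv)

lemma plot_mix:
  assumes "plot D n U a" "plot D n U b" "smooth_function n U t" "t \<in> U \<rightarrow> {0..1}"
  shows "plot D n U (\<lambda>u. mix (t u) (a u) (b u))"
  using assms unfolding mix_def contr_def
  by (intro plot_mult plot_inv plot_retr plot_\<Phi>)

text \<open>An element fixes \<open>\<one>\<close> under this action exactly if it equals its own
  image under \<open>retr\<close>, that is, if it lies in \<open>H\<close>. This is why the level
  set over \<open>\<one>\<close> has structure group \<open>H\<close>.\<close>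

definition twist :: "'g \<Rightarrow> 'g \<Rightarrow> 'g" where
  "twist g k = g \<otimes> k \<otimes> inv (retr g)"

text \<open>Twisting both ends by \<open>g\<close> conjugates \<open>inv a \<otimes> b\<close> by
  \<open>retr g\<close>, an element of \<open>H\<close>, and \<open>contr\<close> commutes with such
  conjugations.\<close>

lemma mix_twist:
  assumes "\<tau> \<in> {0..1}" "g \<in> carrier G" "a \<in> carrier G" "b \<in> carrier G"
  shows "mix \<tau> (twist g a) (twist g b) = twist g (mix \<tau> a b)"
proof -
  have "inv (twist g a) \<otimes> twist g b = retr g \<otimes> (inv a \<otimes> b) \<otimes> inv (retr g)"
    using assms by (simp add: twist_def inv_mult_group m_assoc)
  then have "contr \<tau> (inv (twist g a) \<otimes> twist g b) = retr g \<otimes> contr \<tau> (inv a \<otimes> b) \<otimes> inv (retr g)"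
    using assms retr_H by (simp add: contr_conj)
  then show ?thesis
    using assms by (simp add: mix_def) (simp add: twist_def m_assoc)
qed

end

section \<open>Gluing equivariant maps\<close>

locale reduction = retracted_group G D H \<Phi> + principal G D E X \<pi> act
  for G :: "('g, 'm) monoid_scheme" (structure) and D H \<Phi>
    and E :: "'e diff_space" and X :: "'x diff_space" and \<pi> act
begin

text \<open>Maps stay total and only their behaviour over \<open>W\<close> is recorded, smoothness
  being tested on plots lying over \<open>W\<close>. Restricting \<open>W\<close> then needs no
  change of map.\<close>

definition equivariant_on :: "'x set \<Rightarrow> ('e \<Rightarrow> 'g) \<Rightarrow> bool" where
  "equivariant_on W s \<longleftrightarrow>
     (\<forall>e\<in>carrier E. \<pi> e \<in> W \<longrightarrow>
        s e \<in> carrier G \<and> retr (s e) = \<one> \<and> (\<forall>g\<in>carrier G. s (act g e) = twist g (s e))) \<and>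
     (\<forall>n U p. plot E n U p \<and> (\<forall>u\<in>U. \<pi> (p u) \<in> W) \<longrightarrow> plot D n U (\<lambda>u. s (p u)))"

lemma equivariant_onD:
  assumes "equivariant_on W s" "e \<in> carrier E" "\<pi> e \<in> W"
  shows "s e \<in> carrier G" "retr (s e) = \<one>" "g \<in> carrier G \<Longrightarrow> s (act g e) = twist g (s e)"
  using assms unfolding equivariant_on_def by simp_all

lemma equivariant_on_plot:
  "equivariant_on W s \<Longrightarrow> plot E n U p \<Longrightarrow> (\<And>u. u \<in> U \<Longrightarrow> \<pi> (p u) \<in> W) \<Longrightarrow> plot D n U (\<lambda>u. s (p u))"
  unfolding equivariant_on_def by simp

lemma equivariant_on_mono: "equivariant_on W s \<Longrightarrow> V \<subseteq> W \<Longrightarrow> equivariant_on V s"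
  unfolding equivariant_on_def by (meson subsetD)

text \<open>Only plots with empty domain remain, and on those locality makes any map a plot.\<close>

lemma equivariant_on_empty: "equivariant_on {} s"
proof -
  have "plot D n U (\<lambda>u. s (p u))" if "plot E n U p" "\<forall>u\<in>U. \<pi> (p u) \<in> {}" for n U p
    using that by (intro plot_locally[OF D_diffeological plot_domain(1)[OF E_diffeological that(1)]]) auto
  then show ?thesis
    by (simp add: equivariant_on_def)
qed

text \<open>If \<open>t\<close> divides \<open>e\<close> by the section, then
  \<open>g \<otimes> t\<close> divides \<open>act g e\<close> by it, and \<open>retr\<close> being a
  homomorphism turns this into the twisted action.\<close>

lemma equivariant_on_section:
  assumes q: "\<And>x. x \<in> W \<Longrightarrow> q x \<in> carrier E \<and> \<pi> (q x) = x"
    and plot_q: "\<And>n U p. plot X n U p \<Longrightarrow> (\<And>u. u \<in> U \<Longrightarrow> p u \<in> W) \<Longrightarrow> plot E n U (\<lambda>u. q (p u))"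
  shows "equivariant_on W (\<lambda>e. quot e (q (\<pi> e)) \<otimes> inv (retr (quot e (q (\<pi> e)))))"
proof -
  have "quot (act g e) (q (\<pi> (act g e))) = g \<otimes> quot e (q (\<pi> e))"
    if "e \<in> carrier E" "\<pi> e \<in> W" "g \<in> carrier G" for e g
    using that q[of "\<pi> e"] quot[of e "q (\<pi> e)"] by (intro quot_eqI) (simp_all add: act_mult)
  moreover have "quot e (q (\<pi> e)) \<in> carrier G" if "e \<in> carrier E" "\<pi> e \<in> W" for e
    using that q[of "\<pi> e"] quot[of e "q (\<pi> e)"] by simp
  moreover have "plot D n U (\<lambda>u. quot (p u) (q (\<pi> (p u))))"
    if "plot E n U p" "\<forall>u\<in>U. \<pi> (p u) \<in> W" for n U p
    using that q plot_q[OF smooth_map_plot[OF \<pi>_smooth that(1)]] by (intro plot_quot) auto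
  ultimately show ?thesis
    unfolding equivariant_on_def
    by (auto simp: twist_def \<Phi>_mult \<Phi>_inv inv_mult_group m_assoc intro!: plot_mult plot_inv plot_retr)
qed

text \<open>The outer cases are split off because \<open>s\<close> or \<open>s'\<close> may be
  meaningless where its weight vanishes. For nonnegative weights the last case forces both to be
  positive.\<close>

definition patch :: "('x \<Rightarrow> real) \<Rightarrow> ('x \<Rightarrow> real) \<Rightarrow> ('e \<Rightarrow> 'g) \<Rightarrow> ('e \<Rightarrow> 'g) \<Rightarrow> 'e \<Rightarrow> 'g" where
  "patch a b s s' e =
     (if 2 * a (\<pi> e) \<le> b (\<pi> e) then s e else if 2 * b (\<pi> e) \<le> a (\<pi> e) then s' e
      else mix (blend (a (\<pi> e)) (b (\<pi> e))) (s e) (s' e))"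

text \<open>Algebraically each case is equivariant, the last one by \<open>mix_twist\<close>.
  Smoothness is checked on three open sets: two given by strict versions of the outer conditions,
  and the set where both weights are positive.\<close>

lemma equivariant_on_patch:
  fixes a b :: "'x \<Rightarrow> real"
  assumes s: "equivariant_on {x \<in> carrier X. b x > 0} s"
    and s': "equivariant_on {x \<in> carrier X. a x > 0} s'"
    and nonneg: "\<And>x. x \<in> carrier X \<Longrightarrow> a x \<ge> 0 \<and> b x \<ge> 0"
    and smooth: "\<And>n U p. plot X n U p \<Longrightarrow>
      smooth_function n U (\<lambda>u. a (p u)) \<and> smooth_function n U (\<lambda>u. b (p u))"
  shows "equivariant_on {x \<in> carrier X. a x + b x > 0} (patch a b s s')"
proof -
  have alg: "patch a b s s' e \<in> carrier G \<and> retr (patch a b s s' e) = \<one> \<and>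
      (\<forall>g\<in>carrier G. patch a b s s' (act g e) = twist g (patch a b s s' e))"
    if e: "e \<in> carrier E" and pos: "a (\<pi> e) + b (\<pi> e) > 0" for e
  proof -
    have x: "\<pi> e \<in> carrier X"
      using \<pi>_carrier[OF e] .
    consider "2 * a (\<pi> e) \<le> b (\<pi> e)" "b (\<pi> e) > 0"
      | "\<not> 2 * a (\<pi> e) \<le> b (\<pi> e)" "2 * b (\<pi> e) \<le> a (\<pi> e)" "a (\<pi> e) > 0"
      | "\<not> 2 * a (\<pi> e) \<le> b (\<pi> e)" "\<not> 2 * b (\<pi> e) \<le> a (\<pi> e)" "a (\<pi> e) > 0" "b (\<pi> e) > 0"
      using nonneg[OF x] pos by linarith
    then show ?thesis
    proof cases
      case 1
      then show ?thesis
        using equivariant_onD[OF s e] x e by (simp add: patch_def)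
    next
      case 2
      then show ?thesis
        using equivariant_onD[OF s' e] x e by (simp add: patch_def)
    next
      case 3
      then show ?thesis
        using equivariant_onD[OF s e] equivariant_onD[OF s' e] x e blend_in_unit[of "a (\<pi> e)" "b (\<pi> e)"]
        by (simp add: patch_def mix_closed retr_mix mix_twist del: atLeastAtMost_iff)
    qed
  qed
  have "plot D n U (\<lambda>u. patch a b s s' (p u))"
    if p: "plot E n U p" and pos: "\<forall>u\<in>U. \<pi> (p u) \<in> {x \<in> carrier X. a x + b x > 0}" for n U p
  proof (rule plot_locally[OF D_diffeological plot_domain(1)[OF E_diffeological p]])
    have pX: "plot X n U (\<lambda>u. \<pi> (p u))"
      using smooth_map_plot[OF \<pi>_smooth p] .
    have U: "openin (Euclidean_space n) U"
      using plot_domain(1)[OF E_diffeological p] .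
    have inX: "\<pi> (p u) \<in> carrier X" if "u \<in> U" for u
      using pos that by blast
    let ?a = "\<lambda>u. a (\<pi> (p u))" and ?b = "\<lambda>u. b (\<pi> (p u))"
    have ab: "smooth_function n U ?a" "smooth_function n U ?b" "smooth_function n U (\<lambda>u. 0)"
      using smooth[OF pX] smooth_function_const[OF U] by simp_all
    define V1 where "V1 = {u \<in> U. 2 * ?a u < ?b u}"
    define V2 where "V2 = {u \<in> U. 2 * ?b u < ?a u}"
    define V3 where "V3 = {u \<in> U. 0 < ?a u} \<inter> {u \<in> U. 0 < ?b u}"
    have o: "openin (Euclidean_space n) V1" "openin (Euclidean_space n) V2" "openin (Euclidean_space n) V3"
      unfolding V1_def V2_def V3_def
      by (intro openin_Int smooth_function_open_less smooth_function_cmult ab)+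
    have sub: "V1 \<subseteq> U" "V2 \<subseteq> U" "V3 \<subseteq> U"
      unfolding V1_def V2_def V3_def by auto
    note res = plot_restrict[OF E_diffeological p o(1) sub(1)] plot_restrict[OF E_diffeological p o(2) sub(2)]
      plot_restrict[OF E_diffeological p o(3) sub(3)]
    fix u assume u: "u \<in> U"
    then consider "u \<in> V1" | "u \<in> V2" | "u \<in> V3"
      \<comment> \<open>If one weight vanishes the other is positive, which puts \<open>u\<close>
        into \<open>V1\<close> or \<open>V2\<close>.\<close>
      using nonneg[OF inX[OF u]] pos unfolding V1_def V2_def V3_def by fastforce
    then show "\<exists>V q. u \<in> V \<and> V \<subseteq> U \<and> plot D n V q \<and> (\<forall>v\<in>V. patch a b s s' (p v) = q v)"
    proof cases
      case 1
      have "?b v > 0" if "v \<in> V1" for v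
        using that nonneg[OF inX[of v]] unfolding V1_def by auto
      then have "plot D n V1 (\<lambda>v. s (p v))"
        using inX sub by (intro equivariant_on_plot[OF s res(1)]) auto
      moreover have "patch a b s s' (p v) = s (p v)" if "v \<in> V1" for v
        using that by (simp add: V1_def patch_def)
      ultimately show ?thesis
        using 1 sub by blast
    next
      case 2
      have "?a v > 0" if "v \<in> V2" for v
        using that nonneg[OF inX[of v]] unfolding V2_def by auto
      then have "plot D n V2 (\<lambda>v. s' (p v))"
        using inX sub by (intro equivariant_on_plot[OF s' res(2)]) auto
      moreover have "patch a b s s' (p v) = s' (p v)" if "v \<in> V2" for v
        using that nonneg[OF inX[of v]] by (auto simp: V2_def patch_def)
      ultimately show ?thesis
        using 2 sub by blast
    next
      case 3
      have pos3: "?a v > 0" "?b v > 0" if "v \<in> V3" for v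
        using that unfolding V3_def by auto
      have sV: "plot D n V3 (\<lambda>v. s (p v))" "plot D n V3 (\<lambda>v. s' (p v))"
        using inX sub pos3 by (intro equivariant_on_plot[OF s res(3)] equivariant_on_plot[OF s' res(3)]; auto)+
      have "smooth_function n V3 ?a" "smooth_function n V3 ?b"
        using smooth[OF smooth_map_plot[OF \<pi>_smooth res(3)]] by simp_all
      then have "smooth_function n V3 (\<lambda>v. blend (?a v) (?b v))"
        using pos3 by (intro smooth_function_blend) auto
      then have "plot D n V3 (\<lambda>v. mix (blend (?a v) (?b v)) (s (p v)) (s' (p v)))"
        using blend_in_unit by (intro plot_mix sV) blast+
      \<comment> \<open>One formula covers all of \<open>V3\<close>: in the outer cases
        \<open>blend\<close> is \<open>0\<close> or \<open>1\<close>, and the path is at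
        \<open>s\<close> or \<open>s'\<close>.\<close>
      moreover have "patch a b s s' (p v) = mix (blend (?a v) (?b v)) (s (p v)) (s' (p v))" if v: "v \<in> V3" for v
      proof -
        have e: "p v \<in> carrier E"
          using plot_E_carrier[OF res(3) v] .
        note equivariant_onD[OF s e] equivariant_onD[OF s' e]
        then show ?thesis
          using pos3[OF v] inX[of v] v sub
          by (auto simp: patch_def blend_eq_0 blend_eq_1 mix_0 mix_1)
      qed
      ultimately show ?thesis
        using 3 sub by blast
    qed
  qed
  with alg show ?thesis
    by (simp add: equivariant_on_def)
qed

section \<open>Successive patching along a countable partition of unity\<close>

primrec glue :: "(nat \<Rightarrow> 'x \<Rightarrow> real) \<Rightarrow> (nat \<Rightarrow> 'e \<Rightarrow> 'g) \<Rightarrow> nat \<Rightarrow> 'e \<Rightarrow> 'g" where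
  "glue \<zeta> t 0 = (\<lambda>e. \<one>)"
| "glue \<zeta> t (Suc n) = patch (\<zeta> n) (\<lambda>x. \<Sum>i<n. \<zeta> i x) (glue \<zeta> t n) (t n)"

lemma equivariant_map_exists:
  assumes \<zeta>: "pointwise_finite_smooth_partition X UNIV (\<zeta> :: nat \<Rightarrow> 'x \<Rightarrow> real)"
    and t: "\<And>i. equivariant_on {x \<in> carrier X. \<zeta> i x > 0} (t i)"
  shows "\<exists>s. equivariant_on (carrier X) s"
proof -
  define \<sigma> where "\<sigma> n x = (\<Sum>i<n. \<zeta> i x)" for n x
  have \<zeta>_smooth: "smooth_map X unit_interval (\<zeta> i)" for i
    using \<zeta> by (simp add: pointwise_finite_smooth_partition_def)
  have \<zeta>_nonneg: "\<zeta> i x \<ge> 0" if "x \<in> carrier X" for i x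
    using smooth_map_carrier[OF \<zeta>_smooth that] by simp
  have \<sigma>_nonneg: "\<sigma> n x \<ge> 0" if "x \<in> carrier X" for n x
    using that \<zeta>_nonneg by (simp add: \<sigma>_def sum_nonneg)
  have \<sigma>_mono: "\<sigma> m x \<le> \<sigma> n x" if "x \<in> carrier X" "m \<le> n" for m n x
    unfolding \<sigma>_def using that \<zeta>_nonneg by (intro sum_mono2) auto
  have \<sigma>_1: "\<exists>N. \<forall>n\<ge>N. \<sigma> n x = 1" if x: "x \<in> carrier X" for x
  proof -
    let ?S = "{i. \<zeta> i x \<noteq> 0}"
    have S: "finite ?S" "(\<Sum>i\<in>?S. \<zeta> i x) = 1"
      using \<zeta> x by (simp_all add: pointwise_finite_smooth_partition_def)
    obtain N where N: "?S \<subseteq> {..<N}"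
      using finite_nat_bounded[OF S(1)] by auto
    have "\<sigma> n x = 1" if "n \<ge> N" for n
    proof -
      have "\<sigma> n x = (\<Sum>i\<in>?S. \<zeta> i x)"
        unfolding \<sigma>_def using N that by (intro sum.mono_neutral_right) auto
      with S show ?thesis
        by simp
    qed
    then show ?thesis
      by blast
  qed
  have \<sigma>_le_1: "\<sigma> n x \<le> 1" if x: "x \<in> carrier X" for n x
    using \<sigma>_1[OF x] \<sigma>_mono[OF x] by (metis linear order_trans order_refl)
  have plot_\<zeta>: "smooth_function n U (\<lambda>u. \<zeta> i (p u))" if "plot X n U p" for n U p i
    using smooth_map_plot[OF \<zeta>_smooth that] by simp
  have plot_\<sigma>: "smooth_function n U (\<lambda>u. \<sigma> m (p u))" if "plot X n U p" for n U p m
    unfolding \<sigma>_def using plot_\<zeta>[OF that] plot_domain(1)[OF X_diffeological that]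
    by (intro smooth_function_sum)
  define S where "S = glue \<zeta> t"
  have S: "equivariant_on {x \<in> carrier X. \<sigma> n x > 0} (S n)" for n
  proof (induction n)
    \<comment> \<open>The starting map \<open>\<one>\<close> is a dummy: \<open>\<sigma> 0\<close>
      vanishes, so nothing is claimed about it.\<close>
    case 0
    show ?case
      using equivariant_on_empty by (simp add: \<sigma>_def)
  next
    case (Suc n)
    have "equivariant_on {x \<in> carrier X. \<zeta> n x + \<sigma> n x > 0} (patch (\<zeta> n) (\<sigma> n) (S n) (t n))"
      using Suc.IH t \<zeta>_nonneg \<sigma>_nonneg plot_\<zeta> plot_\<sigma> by (intro equivariant_on_patch) auto
    moreover have "\<sigma> n = (\<lambda>x. \<Sum>i<n. \<zeta> i x)"
      by (simp add: \<sigma>_def fun_eq_iff)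
    ultimately show ?case
      by (simp add: S_def \<sigma>_def add.commute)
  qed
  have stable: "S n e = S m e" if e: "e \<in> carrier E" and m: "\<sigma> m (\<pi> e) > 3 / 4" and "m \<le> n" for m n e
    using \<open>m \<le> n\<close>
  proof (induction n rule: dec_induct)
    case (step n)
    note x = \<pi>_carrier[OF e]
    have "\<sigma> n (\<pi> e) > 3 / 4" "\<zeta> n (\<pi> e) + \<sigma> n (\<pi> e) \<le> 1"
      using m \<sigma>_mono[OF x step.hyps(1)] \<sigma>_le_1[OF x, of "Suc n"] by (simp_all add: \<sigma>_def)
    \<comment> \<open>This selects the first case of \<open>patch\<close>, so stage
      \<open>Suc n\<close> repeats stage \<open>n\<close>.\<close>
    then have "2 * \<zeta> n (\<pi> e) \<le> \<sigma> n (\<pi> e)"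
      by linarith
    then show ?case
      using step.IH by (simp add: S_def patch_def \<sigma>_def)
  qed simp
  \<comment> \<open>The stage is chosen from the base point alone, hence is the same along a
    \<open>G\<close>-orbit, and \<open>s\<close> inherits equivariance from that stage.\<close>
  define N where "N x = (LEAST n. \<sigma> n x > 3 / 4)" for x
  have N: "\<sigma> (N x) x > 3 / 4" if x: "x \<in> carrier X" for x
  proof -
    obtain n where "\<sigma> n x = 1"
      using \<sigma>_1[OF x] by blast
    then show ?thesis
      unfolding N_def by (intro LeastI[of "\<lambda>n. \<sigma> n x > 3 / 4" n]) simp
  qed
  define s where "s e = S (N (\<pi> e)) e" for e
  have s: "s e = S m e" if e: "e \<in> carrier E" and m: "\<sigma> m (\<pi> e) > 3 / 4" for m e
  proof -
    have "N (\<pi> e) \<le> m"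
      unfolding N_def using m by (rule Least_le)
    then show ?thesis
      unfolding s_def by (rule stable[OF e N[OF \<pi>_carrier[OF e]], symmetric])
  qed
  have "s e \<in> carrier G \<and> retr (s e) = \<one> \<and> (\<forall>g\<in>carrier G. s (act g e) = twist g (s e))"
    if e: "e \<in> carrier E" for e
    using equivariant_onD[OF S[of "N (\<pi> e)"] e] N[OF \<pi>_carrier[OF e]] \<pi>_carrier[OF e] e
    by (simp add: s_def)
  moreover have "plot D n U (\<lambda>u. s (p u))" if p: "plot E n U p" for n U p
  proof (rule plot_locally[OF D_diffeological plot_domain(1)[OF E_diffeological p]])
    fix u assume u: "u \<in> U"
    note pX = smooth_map_plot[OF \<pi>_smooth p]
    let ?m = "N (\<pi> (p u))"
    \<comment> \<open>The stage \<open>N\<close> may jump from point to point, but throughout this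
      open set the fixed stage \<open>?m\<close> already gives the final value.\<close>
    define V where "V = {v \<in> U. 3 / 4 < \<sigma> ?m (\<pi> (p v))}"
    have V: "openin (Euclidean_space n) V" "V \<subseteq> U" "u \<in> V"
      unfolding V_def
      using smooth_function_open_less[OF smooth_function_const[OF plot_domain(1)[OF E_diffeological p]]
          plot_\<sigma>[OF pX]] u N[OF \<pi>_carrier[OF plot_E_carrier[OF p u]]] by blast+
    have inV: "p v \<in> carrier E \<and> 3 / 4 < \<sigma> ?m (\<pi> (p v))" if "v \<in> V" for v
      using that plot_E_carrier[OF p] unfolding V_def by blast
    have "\<pi> (p v) \<in> {x \<in> carrier X. \<sigma> ?m x > 0}" if "v \<in> V" for v
      using inV[OF that] \<pi>_carrier[of "p v"] by auto
    then have "plot D n V (\<lambda>v. S ?m (p v))"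
      by (rule equivariant_on_plot[OF S plot_restrict[OF E_diffeological p V(1,2)]])
    moreover have "\<forall>v\<in>V. s (p v) = S ?m (p v)"
      using s inV by blast
    ultimately show "\<exists>V q. u \<in> V \<and> V \<subseteq> U \<and> plot D n V q \<and> (\<forall>v\<in>V. s (p v) = q v)"
      using V by blast
  qed
  ultimately have "equivariant_on (carrier X) s"
    by (simp add: equivariant_on_def)
  then show ?thesis by blast
qed

text \<open>Any trivialisation, equivariant or not, has the smooth sections sending \<open>x\<close>
  to the point with coordinates \<open>(x, f)\<close> for a fixed \<open>f\<close>. Such a section
  suffices.\<close>

lemma local_equivariant_map:
  assumes F: "diffeological_space F"
    and triv: "trivial_bundle (subset_space E {e. \<pi> e \<in> W}) (subset_space X W) \<pi> F"
  shows "\<exists>s. equivariant_on (carrier X \<inter> W) s"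
\<comment> \<open>Over an empty base the fibre \<open>F\<close> may be empty and offer no
  \<open>f\<close>.\<close>
proof (cases "carrier X \<inter> W = {}")
  case True
  then show ?thesis
    using equivariant_on_empty by auto
next
  case False
  then obtain x where "x \<in> \<pi> ` carrier E" "x \<in> W"
    unfolding \<pi>_surj by auto
  then obtain e where e: "e \<in> carrier E" "\<pi> e \<in> W"
    by auto
  let ?P = "prod_space (subset_space X W) F"
  obtain \<psi> where d: "diffeo (subset_space E {e. \<pi> e \<in> W}) ?P \<psi>"
    and fst: "\<forall>e\<in>carrier (subset_space E {e. \<pi> e \<in> W}). fst (\<psi> e) = \<pi> e"
    using triv unfolding trivial_bundle_def by (elim exE conjE)
  from d obtain \<psi>' where \<psi>: "smooth_map (subset_space E {e. \<pi> e \<in> W}) ?P \<psi>"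
    and \<psi>': "smooth_map ?P (subset_space E {e. \<pi> e \<in> W}) \<psi>'"
    and inv: "\<And>y. y \<in> carrier ?P \<Longrightarrow> \<psi> (\<psi>' y) = y"
    by (rule diffeoE) (rule that)
  have "\<psi> e \<in> carrier ?P"
    using e by (intro smooth_map_carrier[OF \<psi>]) simp
  then obtain f where f: "f \<in> carrier F"
    by auto
  have "\<psi>' (x, f) \<in> carrier E \<and> \<pi> (\<psi>' (x, f)) = x" if x: "x \<in> carrier X \<inter> W" for x
  proof -
    have y: "(x, f) \<in> carrier ?P"
      using f x by simp
    then show ?thesis
      using smooth_map_carrier[OF \<psi>' y] bspec[OF fst smooth_map_carrier[OF \<psi>' y]] inv[OF y] by simp
  qed
  moreover have "plot E n U (\<lambda>u. \<psi>' (p u, f))"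
    if p: "plot X n U p" and W: "\<And>u. u \<in> U \<Longrightarrow> p u \<in> carrier X \<inter> W" for n U p
  proof -
    have "plot ?P n U (\<lambda>u. (p u, f))"
      using p W plot_const[OF F plot_domain(1)[OF X_diffeological p] f] by auto
    from smooth_map_plot[OF \<psi>' this] show ?thesis
      by simp
  qed
  ultimately show ?thesis
    by (rule exI[of "equivariant_on (carrier X \<inter> W)",
          OF equivariant_on_section[where q = "\<lambda>x. \<psi>' (x, f)"]])
qed

lemma weakly_D_numerable_equivariant_map:
  assumes "weakly_D_numerable E X \<pi>"
  shows "\<exists>s. equivariant_on (carrier X) s"
proof -
  obtain U :: "nat \<Rightarrow> 'x set" and \<zeta> where triv: "local_trivialisation E X \<pi> (range U)"
    and \<zeta>: "pointwise_finite_smooth_partition X UNIV \<zeta>"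
    and sub: "\<And>i. {x \<in> carrier X. \<zeta> i x \<in> {0<..1}} \<subseteq> U i"
    using assms unfolding weakly_D_numerable_def by blast
  have "\<exists>t. equivariant_on {x \<in> carrier X. \<zeta> i x > 0} t" for i
  proof -
    obtain F :: "'e diff_space" where F: "diffeological_space F"
      "trivial_bundle (subset_space E {e. \<pi> e \<in> U i}) (subset_space X (U i)) \<pi> F"
      using triv unfolding local_trivialisation_def by blast
    obtain s where s: "equivariant_on (carrier X \<inter> U i) s"
      using local_equivariant_map[OF F] by blast
    have "{x \<in> carrier X. \<zeta> i x > 0} \<subseteq> carrier X \<inter> U i"
    proof
      fix x assume x: "x \<in> {x \<in> carrier X. \<zeta> i x > 0}"
      have "smooth_map X unit_interval (\<zeta> i)"
        using \<zeta> by (simp add: pointwise_finite_smooth_partition_def)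
      then have "\<zeta> i x \<in> {0..1}"
        \<comment> \<open>The upper bound is needed because the hypothesis on supports speaks of
          values in the half-open unit interval.\<close>
        using x smooth_map_carrier[of X unit_interval "\<zeta> i" x] by simp
      then show "x \<in> carrier X \<inter> U i"
        using x sub[of i] by auto
    qed
    then show ?thesis
      using equivariant_on_mono[OF s] by blast
  qed
  then obtain t where "\<And>i. equivariant_on {x \<in> carrier X. \<zeta> i x > 0} (t i)"
    by metis
  from equivariant_map_exists[OF \<zeta> this] show ?thesis .
qed

end

section \<open>Reduction of the structure group\<close>

context reduction
begin

section \<open>The level set of an equivariant map over the neutral element\<close>

definition reduced :: "('e \<Rightarrow> 'g) \<Rightarrow> 'e set" where
  "reduced s = {e \<in> carrier E. s e = \<one>}"

lemma
  assumes s: "equivariant_on (carrier X) s" and e: "e \<in> carrier E"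
  shows equivariant_closed: "s e \<in> carrier G" and retr_equivariant: "retr (s e) = \<one>"
    and equivariant_act: "g \<in> carrier G \<Longrightarrow> s (act g e) = twist g (s e)"
  using equivariant_onD[OF s e] \<pi>_carrier[OF e] by simp_all

lemma plot_equivariant:
  "equivariant_on (carrier X) s \<Longrightarrow> plot E n U p \<Longrightarrow> plot D n U (\<lambda>u. s (p u))"
  by (rule equivariant_on_plot) (auto intro: \<pi>_carrier plot_E_carrier)

text \<open>As \<open>s e\<close> lies in the kernel of \<open>retr\<close>, twisting by its inverse
  is plain left multiplication and takes \<open>s e\<close> to \<open>\<one>\<close>. The lemma
  supplies points of the level set in every fibre.\<close>

lemma proj_reduced:
  assumes "equivariant_on (carrier X) s" "e \<in> carrier E"
  shows "act (inv (s e)) e \<in> reduced s"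
  using equivariant_closed[OF assms] retr_equivariant[OF assms] equivariant_act[OF assms] assms(2)
  by (simp add: reduced_def twist_def \<Phi>_inv)

lemma act_reduced:
  assumes "equivariant_on (carrier X) s" "h \<in> H" "e \<in> reduced s"
  shows "act h e \<in> reduced s"
proof -
  have e: "e \<in> carrier E" "s e = \<one>"
    using assms(3) by (simp_all add: reduced_def)
  show ?thesis
    using equivariant_act[OF assms(1) e(1)] assms(2) e by (simp add: reduced_def twist_def \<Phi>_H H_carrier)
qed

text \<open>The quotient \<open>g\<close> satisfies \<open>twist g \<one> = \<one>\<close>, so it
  equals \<open>retr g\<close>, which lies in \<open>H\<close>.\<close>

lemma quot_reduced:
  assumes "equivariant_on (carrier X) s" "e \<in> reduced s" "e' \<in> reduced s" "\<pi> e = \<pi> e'"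
  shows "quot e e' \<in> H"
proof -
  have e: "e \<in> carrier E" "e' \<in> carrier E" "s e = \<one>" "s e' = \<one>"
    using assms(2,3) by (simp_all add: reduced_def)
  let ?g = "quot e e'"
  note g = quot[OF e(1,2) assms(4)]
  have "?g \<otimes> inv (retr ?g) = \<one>"
    using equivariant_act[OF assms(1) e(2) g(1)] e g by (simp add: twist_def)
  then have "inv (inv (retr ?g)) = ?g"
    using g(1) by (intro inv_equality) auto
  then have "?g = retr ?g"
    using g(1) by simp
  then show ?thesis
    using retr_H[OF g(1)] by simp
qed

section \<open>The principal \<open>H\<close>-bundle structure on the level set\<close>

lemma diff_group_H: "diffeological_group (G\<lparr>carrier := H\<rparr>) (subset_space D H)"
  unfolding diffeological_group_def
proof (intro conjI)
  show "group (G\<lparr>carrier := H\<rparr>)"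
    using subgroup.subgroup_is_group[OF subgroup_H is_group] .
  show "diffeological_space (subset_space D H)"
    using diffeological_space_subset[OF D_diffeological] .
  show "carrier (subset_space D H) = carrier (G\<lparr>carrier := H\<rparr>)"
    using H_carrier by auto
  have "plot (subset_space D H) n U (\<lambda>u. fst (p u) \<otimes> snd (p u))"
    if "plot (prod_space (subset_space D H) (subset_space D H)) n U p" for n U p
    using that subgroup.m_closed[OF subgroup_H] by (auto intro!: plot_mult)
  then show "smooth_map (prod_space (subset_space D H) (subset_space D H)) (subset_space D H)
      (\<lambda>(g, h). g \<otimes>\<^bsub>G\<lparr>carrier := H\<rparr>\<^esub> h)"
    using subgroup.m_closed[OF subgroup_H] H_carrier by (intro smooth_mapI) (auto simp: split_beta)
  show "smooth_map (subset_space D H) (subset_space D H) (\<lambda>g. inv\<^bsub>G\<lparr>carrier := H\<rparr>\<^esub> g)"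
  proof (rule smooth_mapI)
    show "inv\<^bsub>G\<lparr>carrier := H\<rparr>\<^esub> g \<in> carrier (subset_space D H)" if "g \<in> carrier (subset_space D H)" for g
      using that m_inv_consistent[OF subgroup_H] subgroup.m_inv_closed[OF subgroup_H] by simp
  next
    fix n U p assume p: "plot (subset_space D H) n U p"
    then have H: "p u \<in> H" if "u \<in> U" for u
      using that by auto
    have "plot (subset_space D H) n U (\<lambda>u. inv (p u))"
      using p plot_inv[of n U p] subgroup.m_inv_closed[OF subgroup_H] by (simp add: Pi_iff)
    \<comment> \<open>The inverses of the two groups are known to agree only on \<open>H\<close>,
      hence the comparison on the domain of the plot.\<close>
    then show "plot (subset_space D H) n U (\<lambda>u. inv\<^bsub>G\<lparr>carrier := H\<rparr>\<^esub> (p u))"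
      by (rule plot_cong[OF diffeological_space_subset[OF D_diffeological]])
        (rule m_inv_consistent[OF subgroup_H H])
  qed
qed

lemma smooth_action_reduced:
  assumes s: "equivariant_on (carrier X) s"
  shows "smooth_action (G\<lparr>carrier := H\<rparr>) (subset_space D H) (subset_space E (reduced s)) act"
  unfolding smooth_action_def
proof
  have "group (G\<lparr>carrier := H\<rparr>)"
    using subgroup.subgroup_is_group[OF subgroup_H is_group] .
  then show "group_action (G\<lparr>carrier := H\<rparr>) (carrier (subset_space E (reduced s)))
      (\<lambda>g. restrict (act g) (carrier (subset_space E (reduced s))))"
    using act_reduced[OF s] by (intro group_actionI) (auto simp: H_carrier act_mult)
  have "plot (subset_space E (reduced s)) n U (\<lambda>u. act (fst (p u)) (snd (p u)))"
    if "plot (prod_space (subset_space D H) (subset_space E (reduced s))) n U p" for n U p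
    using that act_reduced[OF s] by (auto intro!: plot_act)
  then show "smooth_map (prod_space (subset_space D H) (subset_space E (reduced s)))
      (subset_space E (reduced s)) (\<lambda>(g, e). act g e)"
    using act_reduced[OF s] by (intro smooth_mapI) (auto simp: split_beta)
qed

text \<open>A local section \<open>q0\<close> of \<open>E\<close> is pushed into the level set by
  acting with \<open>inv (s (q0 v))\<close>, which is smooth in \<open>v\<close> and preserves
  fibres. The resulting section \<open>q\<close> induces the chart.\<close>

lemma local_product_reduced:
  assumes s: "equivariant_on (carrier X) s" and p: "plot X n U p" and u: "u \<in> U"
  obtains V q where "openin (Euclidean_space n) V" "u \<in> V" "V \<subseteq> U"
    "plot (subset_space E (reduced s)) n V q" "\<forall>v\<in>V. \<pi> (q v) = p v"
    "diffeo (prod_space (euclidean_open n V) (subset_space D H))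
       (pullback (euclidean_open n V) p (subset_space E (reduced s)) \<pi>) (\<lambda>(v, g). (v, act g (q v)))"
proof -
  obtain V q0 where V: "openin (Euclidean_space n) V" "u \<in> V" "V \<subseteq> U" and q0: "plot E n V q0"
    and \<pi>q0: "\<And>v. v \<in> V \<Longrightarrow> \<pi> (q0 v) = p v"
    by (rule local_product[OF p u]) (rule that)
  define q where "q v = act (inv (s (q0 v))) (q0 v)" for v
  have q0E: "q0 v \<in> carrier E" "s (q0 v) \<in> carrier G" if "v \<in> V" for v
    using plot_E_carrier[OF q0 that] equivariant_closed[OF s] by auto
  have plot_q: "plot E n V q"
    unfolding q_def by (intro plot_act plot_inv plot_equivariant[OF s] q0)
  have qP: "q v \<in> reduced s" "\<pi> (q v) = p v" if "v \<in> V" for v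
    using q0E[OF that] \<pi>q0[OF that] proj_reduced[OF s] by (simp_all add: q_def)
  have qE: "q v \<in> carrier E" if "v \<in> V" for v
    using plot_E_carrier[OF plot_q that] .
  let ?A = "prod_space (euclidean_open n V) (subset_space D H)"
  let ?B = "pullback (euclidean_open n V) p (subset_space E (reduced s)) \<pi>"
  have "diffeo ?A ?B (\<lambda>(v, g). (v, act g (q v)))"
  \<comment> \<open>Division by \<open>q\<close> inverts the chart: it is smooth by
    \<open>plot_quot\<close> and has values in \<open>H\<close> by
    \<open>quot_reduced\<close>.\<close>
  proof (rule diffeoI[where g = "\<lambda>(v, e). (v, quot e (q v))"])
    show "smooth_map ?A ?B (\<lambda>(v, g). (v, act g (q v)))"
    proof (rule smooth_mapI)
      show "(case y of (v, g) \<Rightarrow> (v, act g (q v))) \<in> carrier ?B" if "y \<in> carrier ?A" for y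
        using that qE qP act_reduced[OF s] by (auto simp: H_carrier)
      fix m W y assume y: "plot ?A m W y"
      then have fst: "smooth_euclidean m W n V (\<lambda>w. fst (y w))" and snd: "plot D m W (\<lambda>w. snd (y w))"
        and V: "\<And>w. w \<in> W \<Longrightarrow> fst (y w) \<in> V" and H: "\<And>w. w \<in> W \<Longrightarrow> snd (y w) \<in> H"
        by (auto simp: smooth_euclidean_def)
      have "plot E m W (\<lambda>w. act (snd (y w)) (q (fst (y w))))"
        using plot_act[OF snd plot_compose[OF E_diffeological plot_q fst]] .
      then show "plot ?B m W (\<lambda>w. case y w of (v, g) \<Rightarrow> (v, act g (q v)))"
        using fst qE[OF V] qP[OF V] act_reduced[OF s H] H_carrier[OF H] by (simp add: split_beta)
    qed
    show "smooth_map ?B ?A (\<lambda>(v, e). (v, quot e (q v)))"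
    proof (rule smooth_mapI)
      show "(case y of (v, e) \<Rightarrow> (v, quot e (q v))) \<in> carrier ?A" if "y \<in> carrier ?B" for y
        using that qP quot_reduced[OF s] H_carrier by (auto split: prod.splits)
      fix m W y assume y: "plot ?B m W y"
      then have fst: "smooth_euclidean m W n V (\<lambda>w. fst (y w))" and snd: "plot E m W (\<lambda>w. snd (y w))"
        and V: "\<And>w. w \<in> W \<Longrightarrow> fst (y w) \<in> V" and P: "\<And>w. w \<in> W \<Longrightarrow> snd (y w) \<in> reduced s"
        and \<pi>: "\<And>w. w \<in> W \<Longrightarrow> p (fst (y w)) = \<pi> (snd (y w))"
        by (auto simp: smooth_euclidean_def)
      have "plot D m W (\<lambda>w. quot (snd (y w)) (q (fst (y w))))"
        using qP(2)[OF V] \<pi> by (intro plot_quot[OF snd plot_compose[OF E_diffeological plot_q fst]]) simp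
      then show "plot ?A m W (\<lambda>w. case y w of (v, e) \<Rightarrow> (v, quot e (q v)))"
        using fst qP[OF V] P \<pi> quot_reduced[OF s] by (simp add: split_beta)
    qed
    show "(case case y of (v, g) \<Rightarrow> (v, act g (q v)) of (v, e) \<Rightarrow> (v, quot e (q v))) = y"
      if "y \<in> carrier ?A" for y
      using that qE H_carrier by (auto intro: quot_eqI)
    show "(case case y of (v, e) \<Rightarrow> (v, quot e (q v)) of (v, g) \<Rightarrow> (v, act g (q v))) = y"
      if "y \<in> carrier ?B" for y
      using that qE qP by (auto intro!: quot(2))
  qed
  then show thesis
    using V plot_q qP by (intro that) auto
qed

text \<open>The charts of \<open>local_product_reduced\<close> give both local triviality, through
  \<open>fibre_bundleI\<close>, and the principal structure; \<open>proj_reduced\<close> gives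
  surjectivity onto the base.\<close>

lemma principal_bundle_reduced:
  assumes s: "equivariant_on (carrier X) s"
  shows "principal_bundle (G\<lparr>carrier := H\<rparr>) (subset_space D H) (subset_space E (reduced s)) X \<pi> act"
  unfolding principal_bundle_def
proof (intro conjI allI impI)
  show "diffeological_group (G\<lparr>carrier := H\<rparr>) (subset_space D H)"
    by (rule diff_group_H)
  show "smooth_action (G\<lparr>carrier := H\<rparr>) (subset_space D H) (subset_space E (reduced s)) act"
    by (rule smooth_action_reduced[OF s])
  show "fibre_bundle (subset_space E (reduced s)) X \<pi>"
  proof (rule fibre_bundleI)
    show "diffeological_space (subset_space E (reduced s))" "diffeological_space (subset_space D H)"
      "diffeological_space X"
      using diffeological_space_subset E_diffeological D_diffeological X_diffeological by blast+
    show "smooth_map (subset_space E (reduced s)) X \<pi>"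
      using \<pi>_carrier smooth_map_plot[OF \<pi>_smooth] by (intro smooth_mapI) auto
    show "\<pi> ` carrier (subset_space E (reduced s)) = carrier X"
    proof
      show "carrier X \<subseteq> \<pi> ` carrier (subset_space E (reduced s))"
      proof
        fix x assume "x \<in> carrier X"
        then obtain e where e: "e \<in> carrier E" "x = \<pi> e"
          unfolding \<pi>_surj[symmetric] by blast
        then show "x \<in> \<pi> ` carrier (subset_space E (reduced s))"
          using proj_reduced[OF s e(1)] equivariant_closed[OF s e(1)]
          by (intro image_eqI[of _ _ "act (inv (s e)) e"]) auto
      qed
    qed (auto intro: \<pi>_carrier)
    fix n U p u assume p: "plot X n U p" and u: "u \<in> U"
    show "\<exists>V \<theta>. openin (Euclidean_space n) V \<and> u \<in> V \<and> V \<subseteq> U \<and>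
        diffeo (prod_space (euclidean_open n V) (subset_space D H))
          (pullback (euclidean_open n V) p (subset_space E (reduced s)) \<pi>) \<theta> \<and>
        (\<forall>v\<in>V. \<forall>g\<in>carrier (subset_space D H). fst (\<theta> (v, g)) = v)"
      by (rule local_product_reduced[OF s p u], intro exI conjI) (assumption | simp)+
  qed
  fix n U p u assume "plot X n U p \<and> u \<in> U"
  then have p: "plot X n U p" and u: "u \<in> U" by simp_all
  obtain V q where V: "openin (Euclidean_space n) V" "u \<in> V" "V \<subseteq> U"
    and q: "plot (subset_space E (reduced s)) n V q" "\<forall>v\<in>V. \<pi> (q v) = p v"
    and d: "diffeo (prod_space (euclidean_open n V) (subset_space D H))
       (pullback (euclidean_open n V) p (subset_space E (reduced s)) \<pi>) (\<lambda>(v, g). (v, act g (q v)))"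
    by (rule local_product_reduced[OF s p u]) (rule that)
  have "q v \<in> carrier E" if "v \<in> V" for v
    using q(1) plot_E_carrier that by auto
  then have "equivariant (G\<lparr>carrier := H\<rparr>) (prod_space (euclidean_open n V) (subset_space D H))
      (\<lambda>h (v, g). (v, h \<otimes>\<^bsub>G\<lparr>carrier := H\<rparr>\<^esub> g)) (\<lambda>h (v, e). (v, act h e)) (\<lambda>(v, g). (v, act g (q v)))"
    by (auto simp: equivariant_def act_mult H_carrier)
  with V q d show "\<exists>V q. openin (Euclidean_space n) V \<and> u \<in> V \<and> V \<subseteq> U \<and>
      plot (subset_space E (reduced s)) n V q \<and> (\<forall>v\<in>V. \<pi> (q v) = p v) \<and>
      diffeo (prod_space (euclidean_open n V) (subset_space D H))
        (pullback (euclidean_open n V) p (subset_space E (reduced s)) \<pi>) (\<lambda>(v, g). (v, act g (q v))) \<and>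
      equivariant (G\<lparr>carrier := H\<rparr>) (prod_space (euclidean_open n V) (subset_space D H))
        (\<lambda>h (v, g). (v, h \<otimes>\<^bsub>G\<lparr>carrier := H\<rparr>\<^esub> g)) (\<lambda>h (v, e). (v, act h e)) (\<lambda>(v, g). (v, act g (q v)))"
    by (intro exI[of _ V] exI[of _ q] conjI)
qed

text \<open>At time \<open>1\<close> the two actions cancel. At time \<open>0\<close> the outer one
  is trivial, since \<open>retr (s e) = \<one>\<close>, and leaves the projection of
  \<open>proj_reduced\<close>.\<close>

lemma deformation_retraction_reduced:
  assumes s: "equivariant_on (carrier X) s"
  shows "smooth_strong_deformation_retraction E (reduced s)
    (\<lambda>(e, \<tau>). act (\<Phi> (s e, \<tau>)) (act (inv (s e)) e))"
  unfolding smooth_strong_deformation_retraction_def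
proof (intro conjI ballI)
  show "reduced s \<subseteq> carrier E"
    by (auto simp: reduced_def)
  show "smooth_map (prod_space E unit_interval) E (\<lambda>(e, \<tau>). act (\<Phi> (s e, \<tau>)) (act (inv (s e)) e))"
  proof (rule smooth_mapI)
    fix n U y assume "plot (prod_space E unit_interval) n U y"
    then have y: "plot E n U (\<lambda>u. fst (y u))" "smooth_function n U (\<lambda>u. snd (y u))"
      "(\<lambda>u. snd (y u)) \<in> U \<rightarrow> {0..1}"
      by simp_all
    have "plot E n U (\<lambda>u. act (\<Phi> (s (fst (y u)), snd (y u))) (act (inv (s (fst (y u)))) (fst (y u))))"
      by (intro plot_act plot_\<Phi> plot_inv plot_equivariant[OF s] y)
    then show "plot E n U (\<lambda>u. case y u of (e, \<tau>) \<Rightarrow> act (\<Phi> (s e, \<tau>)) (act (inv (s e)) e))"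
      by (simp add: split_beta)
  qed (use equivariant_closed[OF s] in auto)
  show "(case (e, 1) of (e, \<tau>) \<Rightarrow> act (\<Phi> (s e, \<tau>)) (act (inv (s e)) e)) = e" if "e \<in> carrier E" for e
    using that equivariant_closed[OF s] by (simp add: \<Phi>_1)
  show "(\<lambda>(e, \<tau>). act (\<Phi> (s e, \<tau>)) (act (inv (s e)) e)) ` (carrier E \<times> {0}) \<subseteq> reduced s"
    using proj_reduced[OF s] retr_equivariant[OF s] equivariant_closed[OF s] by auto
  \<comment> \<open>On the level set \<open>s e\<close> is \<open>\<one>\<close>, an element of
    \<open>H\<close>, which \<open>\<Phi>\<close> fixes at all times.\<close>
  show "(case (e, \<tau>) of (e, \<tau>) \<Rightarrow> act (\<Phi> (s e, \<tau>)) (act (inv (s e)) e)) = e"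
    if "e \<in> reduced s" "\<tau> \<in> {0..1}" for e \<tau>
    using that \<Phi>_H[OF subgroup.one_closed[OF subgroup_H]] by (simp add: reduced_def)
qed

end

theorem corollary5p6:
  fixes G :: "'g monoid" and D :: "'g diff_space" and H :: "'g set"
    and \<Phi> :: "'g \<times> real \<Rightarrow> 'g"
    and X :: "'x diff_space" and E :: "'e diff_space"
    and \<pi> :: "'e \<Rightarrow> 'x" and act :: "'g \<Rightarrow> 'e \<Rightarrow> 'e"
  assumes "diffeological_group G D"
    and "subgroup H G"
    and "smooth_strong_deformation_retraction D H \<Phi>"
    and "\<forall>\<tau>\<in>{0..1}. (\<lambda>g. \<Phi> (g, \<tau>)) \<in> hom G G"
    and "diffeological_space X"
    and "Hausdorff_space (D_topology X)"
    and "smoothly_paracompact X"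
    and "principal_bundle G D E X \<pi> act"
    and "weakly_D_numerable E X \<pi>"
  shows "\<exists>(E' :: 'e diff_space) \<pi>' act' f P \<Psi>.
           principal_bundle G D E' X \<pi>' act' \<and>
           principal_bundle_iso G E \<pi> act E' \<pi>' act' f \<and>
           P \<subseteq> carrier E' \<and>
           principal_bundle (G\<lparr>carrier := H\<rparr>) (subset_space D H) (subset_space E' P) X \<pi>' act' \<and>
           smooth_strong_deformation_retraction E' P \<Psi>"
proof -
  have "group G"
    using assms(1) by (simp add: diffeological_group_def)
  then interpret reduction G D H \<Phi> E X \<pi> act
    using assms(1-4,8)
    by (simp add: reduction_def retracted_group_def principal_def diff_group_def
        diff_group_axioms_def retracted_group_axioms_def principal_axioms_def)
  obtain s where s: "equivariant_on (carrier X) s"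
    using weakly_D_numerable_equivariant_map[OF assms(9)] by blast
  have "principal_bundle_iso G E \<pi> act E \<pi> act (\<lambda>e. e)"
    by (simp add: principal_bundle_iso_def equivariant_def diffeo_ident)
  moreover have "reduced s \<subseteq> carrier E"
    by (auto simp: reduced_def)
  ultimately show ?thesis
    using assms(8) principal_bundle_reduced[OF s] deformation_retraction_reduced[OF s]
    by (intro exI[of _ E] exI[of _ \<pi>] exI[of _ act] exI[of _ "\<lambda>e. e"] exI[of _ "reduced s"] exI conjI)
qed

end
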